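(* Let $a,b$ be real numbers with $0<a\le b$ and $a+b\le\tfrac12$. Then $$\kappa[a,b,1]\ \ge\ \frac{3a-b-1}{2}+\frac{b+b^2-2a^2-3ab}{(1+b)(a+b)}.$$ In particular, $w_{a,b,1}$ is convex when $$(3b-1)a^2+(2b^2-5b-1)a+b(1-b^2)\ge0.$$
   Context: $\mathbb{D}=\{z\in\mathbb{C}:|z|<1\}$. The Gaussian hypergeometric function is ${}_2F_1(a,b;c;z)=\sum_{n\ge0}\frac{(a)_n(b)_n}{(c)_n\,n!}z^n$ for $z\in\mathbb{D}$, where $(a)_0=1$, $(a)_n=a(a+1)\cdots(a+n-1)$, and $c\notin\{0,-1,-2,\dots\}$. Put $w_{a,b,c}(z)=\dfrac{{}_2F_1(a+1,b;c;z)}{{}_2F_1(a,b;c;z)}$ for $z\in\mathbb{D}$. For a non-constant holomorphic function $f$ on $\mathbb{D}$, the order of convexity is $\kappa(f)=1+\inf_{z\in\mathbb{D}}\operatorname{Re}\frac{zf''(z)}{f'(z)}\in[-\infty,1]$; $f$ is called convex if $\kappa(f)\ge0$ (equivalently, $f$ is univalent on $\mathbb{D}$ and $f(\mathbb{D})$ is a convex domain). We write $\kappa[a,b,c]=\kappa(w_{a,b,c})$. *)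

theory Defs
  imports "HOL-Complex_Analysis.Complex_Analysis"
begin

text \<open>Only meaningful for \<open>norm z < 1\<close> and \<open>c\<close> not a non-positive integer.\<close>

definition hyp2F1 :: "complex \<Rightarrow> complex \<Rightarrow> complex \<Rightarrow> complex \<Rightarrow> complex" where
  "hyp2F1 a b c z =
     (\<Sum>n. pochhammer a n * pochhammer b n / (pochhammer c n * fact n) * z ^ n)"

lemma hyp2F1_eq_eval_fps: "hyp2F1 a b c z = eval_fps (fps_hypergeo [a, b] [c] 1) z"
  by (simp add: hyp2F1_def eval_fps_def)

definition hyp_ratio :: "complex \<Rightarrow> complex \<Rightarrow> complex \<Rightarrow> complex \<Rightarrow> complex" where
  "hyp_ratio a b c z = hyp2F1 (a + 1) b c z / hyp2F1 a b c z"

text \<open>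
  The quotient \<open>z * f''(z) / f'(z)\<close> is undefined at the zeros of \<open>f'\<close>, where division in
  HOL would return 0.  Such points are given the value \<open>-\<infinity>\<close> instead.  At a zero of \<open>f'\<close>
  other than 0 the quotient has a simple pole, so its real part is unbounded below nearby and
  the infimum is \<open>-\<infinity>\<close> anyway; at the point 0 this choice keeps the order in \<open>[-\<infinity>, 1]\<close>
  and keeps functions that are not locally injective at 0, such as \<open>z\<^sup>2\<close>, from being
  convex.
\<close>

definition order_of_convexity :: "(complex \<Rightarrow> complex) \<Rightarrow> ereal" where
  "order_of_convexity f =
     1 + (INF z\<in>ball 0 1. if deriv f z = 0 then -\<infinity>
                          else ereal (Re (z * deriv (deriv f) z / deriv f z)))"

definition convex_function_on_disc :: "(complex \<Rightarrow> complex) \<Rightarrow> bool" where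
  "convex_function_on_disc f \<longleftrightarrow>
     f holomorphic_on ball 0 1 \<and> \<not> f constant_on ball 0 1 \<and> order_of_convexity f \<ge> 0"

definition hyp_kappa :: "complex \<Rightarrow> complex \<Rightarrow> complex \<Rightarrow> ereal" where
  "hyp_kappa a b c = order_of_convexity (hyp_ratio a b c)"

end

theory Submission
  imports Defs
begin

text \<open>
  Let \<open>F\<close> and \<open>w\<close> be the hypergeometric function and the ratio in question, and put \<open>w = 1 + z s\<close>,
  \<open>y = (1 - z) s\<close>, \<open>A = s / w\<close>, \<open>p = z / (1 - z)\<close>. The hypergeometric equation turns into Riccati
  equations for \<open>w\<close>, \<open>y\<close>, \<open>A\<close>, and differentiating that of \<open>w\<close> gives
  \<open>z w'' / w' = (1 + a + b) p - 2 a (w - 1) + Q / (1 - Q)\<close> with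
  \<open>Q = a z s\<^sup>2 / (w (a z s + b))\<close>, where
  \<open>((a + b) / a) Q / (1 - Q) = w - 2 + (1 - A + y) / (1 - Q)\<close>.
  Since \<open>1 / (a + b) \<ge> 2\<close>, the bound follows from \<open>Re p \<ge> - 1/2\<close>, \<open>Re w \<ge> 1 / (1 + b)\<close> and
  \<open>Re ((1 - A + y) / (1 - Q)) \<ge> 0\<close>. Jack's lemma applied to the Riccati equations yields
  \<open>Re w > 1 / (1 + b)\<close> and \<open>Re y > 0\<close>; with Schwarz's lemma, \<open>|A| < 1\<close> and \<open>|Q| < 1\<close>, so numerator
  and denominator of the last quotient have positive real part. Following the Riccati equations
  along rays in the upper half disc shows \<open>Im y < 0\<close> and \<open>Im A > 0\<close> there, and these imply
  \<open>Im Q \<ge> 0\<close>; hence the imaginary parts of numerator and denominator have the same sign.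
\<close>

subsection \<open>Half-plane criteria for differential equations in the disc\<close>

text \<open>
  Jack's lemma for a half-plane: at a point of minimal modulus where \<open>Re f\<close> vanishes, Schwarz's
  lemma for \<open>(c - f) / (c + f)\<close> forces the radial derivative of \<open>f\<close> to be real and at most
  \<open>- (c\<^sup>2 + \<eta>\<^sup>2) / (2 c)\<close>.
\<close>

lemma Re_pos_if_no_first_exit:
  fixes f :: "complex \<Rightarrow> complex" and c :: real
  assumes holo: "f holomorphic_on ball 0 1" and f0: "f 0 = of_real c" and "c > 0"
    and no_exit: "\<And>z \<sigma> \<eta>. norm z < 1 \<Longrightarrow> f z = \<i> * of_real \<eta> \<Longrightarrow>
      z * deriv f z = - of_real \<sigma> \<Longrightarrow> (c\<^sup>2 + \<eta>\<^sup>2) / (2 * c) \<le> \<sigma> \<Longrightarrow> False"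
    and z: "norm z < 1"
  shows "Re (f z) > 0"
proof (rule ccontr)
  assume "\<not> Re (f z) > 0"
  have cont: "continuous_on (ball 0 1) f"
    using holo by (rule holomorphic_on_imp_continuous_on)
  define K where "K = {x \<in> cball 0 (norm z). Re (f x) \<le> 0}"
  have sub: "cball 0 (norm z) \<subseteq> ball (0::complex) 1"
    using z by auto
  have "compact K"
  proof -
    have "closed K"
      unfolding K_def using sub
      by (intro continuous_on_closed_Collect_le continuous_on_subset [OF cont] continuous_intros) auto
    then show ?thesis
      unfolding K_def by (metis (no_types, lifting) bounded_cball bounded_subset compact_eq_bounded_closed mem_Collect_eq subsetI)
  qed
  moreover have "z \<in> K"
    using \<open>\<not> Re (f z) > 0\<close> by (auto simp: K_def)
  ultimately obtain z0 where z0: "z0 \<in> K" and min: "\<And>x. x \<in> K \<Longrightarrow> norm z0 \<le> norm x"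
    using continuous_attains_inf [of K norm] continuous_on_norm_id by blast
  have z0z: "norm z0 \<le> norm z" "norm z0 < 1" "Re (f z0) \<le> 0"
    using z0 z by (auto simp: K_def)
  have pos: "Re (f x) > 0" if "norm x < norm z0" for x
    using min [of x] that z0z by (fastforce simp: K_def)
  have "z0 \<noteq> 0"
    using z0z f0 \<open>c > 0\<close> by auto
  \<comment> \<open>On the circle through \<open>z0\<close> the weak inequality survives as a radial
    limit from inside.\<close>
  have nonneg: "Re (f x) \<ge> 0" if "norm x = norm z0" for x
  proof (rule tendsto_lowerbound)
    have "isCont f x"
      using that z0z cont by (simp add: continuous_on_eq_continuous_at)
    then have "(f \<longlongrightarrow> f x) (at x)" by (simp add: isCont_def)
    moreover have "filterlim (\<lambda>t. of_real t * x) (at x) (at_left (1::real))"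
      unfolding filterlim_at using \<open>z0 \<noteq> 0\<close> that
      by (auto intro!: tendsto_eq_intros eventually_at_leftI [of 0] simp: mult_cancel_right1)
    ultimately show "((\<lambda>t. Re (f (of_real t * x))) \<longlongrightarrow> Re (f x)) (at_left (1::real))"
      by (intro tendsto_Re) (rule filterlim_compose)
    show "\<forall>\<^sub>F t in at_left 1. 0 \<le> Re (f (of_real t * x))"
    proof (rule eventually_at_leftI [of 0])
      fix t :: real assume "t \<in> {0<..<1}"
      then have "norm (of_real t * x) < norm z0"
        using that \<open>z0 \<noteq> 0\<close> by (simp add: norm_mult)
      then show "0 \<le> Re (f (of_real t * x))"
        using pos less_imp_le by blast
    qed simp
  qed simp
  have Re0: "Re (f z0) = 0"
    using nonneg [of z0] z0z by simp
  define \<eta> where "\<eta> = Im (f z0)"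
  define d where "d = z0 * deriv f z0"
  have der: "(f has_field_derivative deriv f z0) (at z0)"
    using holo z0z by (simp add: holomorphic_derivI)
  have der_curve: "((\<lambda>t. f (\<gamma> t)) has_vector_derivative \<gamma>' * deriv f z0) (at t)"
    if "(\<gamma> has_vector_derivative \<gamma>') (at t)" "\<gamma> t = z0" for \<gamma> \<gamma>' and t :: real
    using field_vector_diff_chain_at [of \<gamma> \<gamma>' t f "deriv f z0"] that der by (simp add: o_def)
  \<comment> \<open>On the circle \<open>Re f\<close> is minimal at \<open>z0\<close>, so its
    tangential derivative \<open>Re (\<i> * d)\<close> vanishes and \<open>d\<close> is
    real.\<close>
  have "((\<lambda>t. Re (f (z0 * cis t))) has_real_derivative Re (\<i> * d)) (at 0)"
  proof -
    have "((\<lambda>t. z0 * cis t) has_vector_derivative z0 * \<i>) (at 0)"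
      unfolding cis_conv_exp
      by (rule has_vector_derivative_real_field [of "\<lambda>t. z0 * exp (\<i> * t)"])
        (auto intro!: derivative_eq_intros)
    from der_curve [OF this] show ?thesis
      by (intro has_field_derivative_Re) (simp_all add: d_def mult_ac)
  qed
  moreover have "\<forall>t. \<bar>0 - t\<bar> < 1 \<longrightarrow> Re (f (z0 * cis 0)) \<le> Re (f (z0 * cis t))"
    using nonneg Re0 by (simp add: norm_mult)
  ultimately have "Re (\<i> * d) = 0"
    by (rule DERIV_local_min [OF _ zero_less_one])
  then have "Im d = 0" by simp
  \<comment> \<open>\<open>k t \<le> 0\<close> is the squared Schwarz inequality
    \<open>norm (c - f) \<le> t * norm (c + f)\<close> at \<open>t * z0\<close>. Together with
    \<open>k 1 = 0\<close> it forces a nonnegative derivative at 1, which is the bound on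
    \<open>- Re d\<close>.\<close>
  define k where "k t = (c - Re (f (of_real t * z0)))\<^sup>2 + (Im (f (of_real t * z0)))\<^sup>2
      - t\<^sup>2 * ((c + Re (f (of_real t * z0)))\<^sup>2 + (Im (f (of_real t * z0)))\<^sup>2)" for t
  have k1: "k 1 = 0"
    by (simp add: k_def Re0)
  have k_le: "k t \<le> 0" if "0 < t" "t < 1" for t
  proof -
    \<comment> \<open>The disc of radius \<open>norm z0\<close>, where \<open>Re f > 0\<close>, is
      rescaled to the unit disc before Schwarz's lemma is applied.\<close>
    define h where "h \<zeta> = (of_real c - f (\<zeta> * z0)) / (of_real c + f (\<zeta> * z0))" for \<zeta>
    have small: "norm (\<zeta> * z0) < norm z0" if "norm \<zeta> < 1" for \<zeta>
      using that \<open>z0 \<noteq> 0\<close> by (simp add: norm_mult)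
    have less: "norm (of_real c - w) < norm (of_real c + w)" if "Re w > 0" for w
    proof -
      have "(c - Re w)\<^sup>2 < (c + Re w)\<^sup>2"
        using that \<open>c > 0\<close> by (simp add: power2_eq_square algebra_simps)
      then show ?thesis by (simp add: cmod_def)
    qed
    have ne: "of_real c + f (\<zeta> * z0) \<noteq> 0" if "norm \<zeta> < 1" for \<zeta>
      using less [OF pos [OF small [OF that]]] by auto
    have "(\<lambda>\<zeta>. f (\<zeta> * z0)) holomorphic_on ball 0 1"
      by (rule holomorphic_on_compose_gen [of "\<lambda>\<zeta>. \<zeta> * z0" _ f "ball 0 1", unfolded o_def])
        (use holo small z0z in \<open>force intro!: holomorphic_intros\<close>)+
    then have "h holomorphic_on ball 0 1"
      unfolding h_def using ne
      by (intro holomorphic_on_divide holomorphic_on_diff holomorphic_on_add holomorphic_on_const) auto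
    moreover have "h 0 = 0"
      by (simp add: h_def f0)
    moreover have "norm (h \<zeta>) < 1" if "norm \<zeta> < 1" for \<zeta>
      using less [OF pos [OF small [OF that]]] ne [OF that] by (simp add: h_def norm_divide)
    ultimately have "norm (h (of_real t)) \<le> norm (of_real t :: complex)"
      using that by (intro Schwarz_Lemma) auto
    then have "norm (of_real c - f (of_real t * z0)) \<le> t * norm (of_real c + f (of_real t * z0))"
      using ne [of "of_real t"] that by (simp add: h_def norm_divide field_simps)
    then have "(norm (of_real c - f (of_real t * z0)))\<^sup>2 \<le> (t * norm (of_real c + f (of_real t * z0)))\<^sup>2"
      by (rule power_mono) simp
    then show ?thesis
      by (simp add: k_def power_mult_distrib cmod_power2)
  qed
  have k_der: "(k has_real_derivative - 4 * c * Re d - 2 * (c\<^sup>2 + \<eta>\<^sup>2)) (at 1)"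
  proof -
    have v: "((\<lambda>t. f (of_real t * z0)) has_vector_derivative d) (at 1)"
    proof -
      have "((\<lambda>t. of_real t * z0) has_vector_derivative 1 * z0) (at (1::real))"
        by (intro has_vector_derivative_mult_left has_vector_derivative_of_real) (auto intro!: derivative_eq_intros)
      from der_curve [OF this] show ?thesis by (simp add: d_def)
    qed
    show ?thesis
      unfolding k_def
      by (rule derivative_eq_intros has_field_derivative_Re [OF v] has_field_derivative_Im [OF v] refl)+
        (simp add: Re0 \<eta>_def [symmetric] power2_eq_square algebra_simps)
  qed
  have "\<not> - 4 * c * Re d - 2 * (c\<^sup>2 + \<eta>\<^sup>2) < 0"
  proof
    assume neg: "- 4 * c * Re d - 2 * (c\<^sup>2 + \<eta>\<^sup>2) < 0"
    from DERIV_neg_dec_left [OF k_der neg]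
    obtain e where "e > 0" and e: "\<And>h. 0 < h \<Longrightarrow> h < e \<Longrightarrow> k 1 < k (1 - h)" by blast
    define x where "x = min (e/2) (1/2)"
    have "0 < x" "x < e" "x < 1"
      using \<open>e > 0\<close> by (auto simp: x_def)
    then show False
      using e [of x] k_le [of "1 - x"] k1 by simp
  qed
  then have "(c\<^sup>2 + \<eta>\<^sup>2) / (2 * c) \<le> - Re d"
    using \<open>c > 0\<close> by (simp add: field_simps)
  then show False
    using z0z Re0 \<open>Im d = 0\<close>
    by (intro no_exit [of z0 \<eta> "- Re d"]) (auto simp: complex_eq_iff \<eta>_def d_def [symmetric])
qed

text \<open>By the equation, \<open>t * f (t * z)\<close> has derivative
  \<open>c + t * z / (1 - t * z) * q (t * z)\<close> in \<open>t\<close>. At a zero of its imaginary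
  part with \<open>t > 0\<close>, \<open>q\<close> is real and positive and
  \<open>Im (t * z / (1 - t * z))\<close> has the sign of \<open>Im z\<close>. So
  \<open>Im z * Im (t * f (t * z))\<close>, which first grows from 0, would have to increase through
  any later zero.\<close>

lemma Im_pos_along_rays:
  fixes f q :: "complex \<Rightarrow> complex" and c q0 :: real
  assumes holo: "f holomorphic_on ball 0 1"
    and ode: "\<And>z. norm z < 1 \<Longrightarrow> f z + z * deriv f z = of_real c + z / (1 - z) * q z"
    and q_cont: "isCont q 0" and q_0: "q 0 = of_real q0" "q0 > 0"
    and q_pos: "\<And>z. norm z < 1 \<Longrightarrow> Im z \<noteq> 0 \<Longrightarrow> Im (f z) = 0 \<Longrightarrow> Im (q z) = 0 \<and> Re (q z) > 0"
    and z: "norm z < 1" "Im z \<noteq> 0"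
  shows "Im z * Im (f z) > 0"
proof -
  define V where "V t = Im z * Im (of_real t * f (of_real t * z))" for t
  define V' where "V' t = Im z * Im (of_real t * z / (1 - of_real t * z) * q (of_real t * z))" for t
  have small: "norm (of_real t * z) < 1" if "t \<in> {0..1}" for t
  proof -
    have "\<bar>t\<bar> * norm z \<le> 1 * norm z"
      using that by (intro mult_right_mono) auto
    then show ?thesis using z by (simp add: norm_mult)
  qed
  have der: "(V has_real_derivative V' t) (at t)" if "t \<in> {0..1}" for t
  proof -
    have fd: "(f has_field_derivative deriv f (of_real t * z)) (at (of_real t * z))"
      using holo small [OF that] by (simp add: holomorphic_derivI)
    have "((\<lambda>t. of_real t * z) has_vector_derivative 1 * z) (at t)"
      by (intro has_vector_derivative_mult_left has_vector_derivative_of_real)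
        (auto intro!: derivative_eq_intros)
    from field_vector_diff_chain_at [OF this fd]
    have "((\<lambda>t. f (of_real t * z)) has_vector_derivative z * deriv f (of_real t * z)) (at t)"
      by (simp add: o_def)
    then have "((\<lambda>t. of_real t * f (of_real t * z)) has_vector_derivative
        of_real t * (z * deriv f (of_real t * z)) + 1 * f (of_real t * z)) (at t)"
      by (intro has_vector_derivative_mult has_vector_derivative_of_real)
        (auto intro!: derivative_eq_intros)
    moreover have "of_real t * (z * deriv f (of_real t * z)) + 1 * f (of_real t * z)
        = of_real c + of_real t * z / (1 - of_real t * z) * q (of_real t * z)"
      using ode [OF small [OF that]] by (simp add: algebra_simps)
    ultimately have "((\<lambda>t. Im (of_real t * f (of_real t * z))) has_real_derivative
        Im (of_real c + of_real t * z / (1 - of_real t * z) * q (of_real t * z))) (at t)"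
      by (metis has_field_derivative_Im)
    from DERIV_cmult [OF this, of "Im z"] show ?thesis
      unfolding V_def V'_def by simp
  qed
  have "\<forall>\<^sub>F t in at_right 0. V' t > 0"
  proof -
    \<comment> \<open>\<open>V'\<close> vanishes at 0, so its sign near 0 is read off from the
      cofactor in \<open>V' t = t * R t\<close>, which tends to
      \<open>(Im z)^2 * q0\<close>.\<close>
    define R where "R t = Im z * Im (z / (1 - of_real t * z) * q (of_real t * z))" for t
    have "(R \<longlongrightarrow> Im z * Im (z / (1 - of_real 0 * z) * q (of_real 0 * z))) (at_right 0)"
      unfolding R_def
    proof (intro tendsto_intros)
      have "((\<lambda>t. of_real t * z) \<longlongrightarrow> 0) (at_right (0::real))"
        by (auto intro!: tendsto_eq_intros)
      then show "((\<lambda>t. q (of_real t * z)) \<longlongrightarrow> q (of_real 0 * z)) (at_right (0::real))"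
        using isCont_tendsto_compose [OF q_cont] by simp
    qed auto
    moreover have "Im z * Im (z / (1 - of_real 0 * z) * q (of_real 0 * z)) > 0"
      using q_0 z by (auto simp: zero_less_mult_iff mult_less_0_iff linorder_neq_iff)
    ultimately have "\<forall>\<^sub>F t in at_right 0. R t > 0"
      by (rule order_tendstoD)
    moreover have "\<forall>\<^sub>F t in at_right 0. t > (0::real)"
      by (simp add: eventually_at_right_less)
    ultimately show ?thesis
    proof eventually_elim
      case (elim t)
      have "V' t = t * R t"
        by (simp add: V'_def R_def mult.assoc Im_divide Re_divide algebra_simps)
      with elim show ?case by simp
    qed
  qed
  then obtain \<delta> where "\<delta> > 0" and \<delta>: "\<And>t. 0 < t \<Longrightarrow> t < \<delta> \<Longrightarrow> V' t > 0"
    by (auto simp: eventually_at_right_field)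
  have V0: "V 0 = 0" by (simp add: V_def)
  have cont: "continuous_on {0..1} V"
    using der by (meson DERIV_isCont continuous_at_imp_continuous_on)
  have near_0: "V t > 0" if "0 < t" "t < \<delta>" "t \<le> 1" for t
  proof -
    have "\<exists>\<xi>>0. \<xi> < t \<and> V t - V 0 = (t - 0) * V' \<xi>"
      using that der by (intro MVT2) auto
    then show ?thesis using \<delta> V0 that by auto
  qed
  have "V 1 > 0"
  proof (rule ccontr)
    assume "\<not> V 1 > 0"
    \<comment> \<open>Starting at \<open>e > 0\<close> keeps the search for a first zero away from
      the trivial zero \<open>V 0 = 0\<close>.\<close>
    define e where "e = min (\<delta>/2) 1"
    have e: "0 < e" "e < \<delta>" "e \<le> 1" using \<open>\<delta> > 0\<close> by (auto simp: e_def)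
    define K where "K = {t \<in> {e..1}. V t \<le> 0}"
    have "closed K"
      unfolding K_def using e
      by (intro continuous_on_closed_Collect_le continuous_on_subset [OF cont] continuous_intros) auto
    moreover have "K \<subseteq> {e..1}" by (auto simp: K_def)
    ultimately have "compact K"
      by (metis bounded_closed_interval bounded_subset compact_eq_bounded_closed)
    moreover have "1 \<in> K" using \<open>\<not> V 1 > 0\<close> e by (auto simp: K_def)
    ultimately obtain s where s: "s \<in> K" and s_min: "\<And>t. t \<in> K \<Longrightarrow> s \<le> t"
      using compact_attains_inf [of K] by blast
    have "e < s" using s near_0 [OF e] by (cases "s = e") (auto simp: K_def)
    have before: "V t > 0" if "e \<le> t" "t < s" for t
      using s_min [of t] that s by (force simp: K_def)
    have "V s \<ge> 0"
    proof (rule tendsto_lowerbound)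
      show "(V \<longlongrightarrow> V s) (at_left s)"
        using der [of s] s e DERIV_isCont [of V]
        by (auto simp: K_def isCont_def intro: tendsto_mono [OF at_le])
      show "\<forall>\<^sub>F t in at_left s. 0 \<le> V t"
        using before \<open>e < s\<close> by (intro eventually_at_leftI [of e]) (auto intro: less_imp_le)
    qed simp
    then have "V s = 0" using s by (auto simp: K_def)
    have s01: "0 < s" "s \<le> 1" using \<open>e < s\<close> e s by (auto simp: K_def)
    have "Im (f (of_real s * z)) = 0"
      using \<open>V s = 0\<close> s01 z by (simp add: V_def)
    then have q: "Im (q (of_real s * z)) = 0" "Re (q (of_real s * z)) > 0"
      using q_pos [of "of_real s * z"] small [of s] s01 z by auto
    have ne: "1 - of_real s * z \<noteq> 0"
      using small [of s] s01 by auto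
    have "of_real s * z / (1 - of_real s * z) = 1 / (1 - of_real s * z) - 1"
      using ne by (simp add: field_simps)
    then have "Im (of_real s * z / (1 - of_real s * z)) = s * Im z / (norm (1 - of_real s * z))\<^sup>2"
      by (simp only:) (simp add: Im_divide cmod_power2)
    moreover have "V' s = Im z * (Im (of_real s * z / (1 - of_real s * z)) * Re (q (of_real s * z)))"
      unfolding V'_def times_complex.sel(2) [of "of_real s * z / (1 - of_real s * z)"] q(1) by simp
    ultimately have "V' s = (Im z)\<^sup>2 * s / (norm (1 - of_real s * z))\<^sup>2 * Re (q (of_real s * z))"
      by (simp add: power2_eq_square)
    then have "V' s > 0"
      using q z s01 ne by simp
    \<comment> \<open>A positive derivative at the zero \<open>s\<close> requires negative values
      just to its left, where \<open>V\<close> is positive.\<close>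
    from DERIV_pos_inc_left [OF der this] s01
    obtain \<epsilon> where "\<epsilon> > 0" "\<And>h. 0 < h \<Longrightarrow> h < \<epsilon> \<Longrightarrow> V (s - h) < V s"
      by auto
    then show False
      using before [of "s - min (\<epsilon>/2) (s - e)"] \<open>V s = 0\<close> \<open>e < s\<close>
      by (auto simp: min_def split: if_splits) (smt (verit) field_sum_of_halves)+
  qed
  then show ?thesis by (simp add: V_def)
qed

text \<open>The equation says \<open>U = z * (U + V)\<close>, so
  \<open>norm U \<le> norm (U + V)\<close>, whereas the last hypothesis is
  \<open>norm (U + V) < norm U\<close> in coordinates. This rules out a first exit without solving
  for the exit point.\<close>

lemma no_disc_solution:
  fixes z U V :: complex
  assumes "norm z < 1" "(1 - z) * U = z * V"
    and "(Re V)\<^sup>2 + (Im V)\<^sup>2 + 2 * (Re U * Re V + Im U * Im V) < 0"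
  shows False
proof -
  have "U = z * (U + V)"
    using assms(2) by (simp add: algebra_simps)
  then have "norm U = norm z * norm (U + V)"
    by (metis norm_mult)
  also have "\<dots> \<le> norm (U + V)"
    using assms(1) by (simp add: mult_left_le_one_le)
  finally have "(norm U)\<^sup>2 \<le> (norm (U + V))\<^sup>2"
    by simp
  then show False
    using assms(3) unfolding cmod_power2 by (simp add: power2_eq_square algebra_simps)
qed

text \<open>Such \<open>u\<close> is closer to 1 than to 0.\<close>

lemma norm_ratio_less:
  assumes "Re u > 1 / 2"
  shows "norm ((u - 1) / u) < 1"
proof -
  have "u \<noteq> 0" using assms by auto
  have "(norm (u - 1))\<^sup>2 < (norm u)\<^sup>2"
    using assms unfolding cmod_power2 by (simp add: power2_eq_square algebra_simps)
  then have "norm (u - 1) < norm u" by (simp add: power_less_imp_less_base)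
  then show ?thesis using \<open>u \<noteq> 0\<close> by (simp add: norm_divide)
qed

text \<open>The expression is a nonnegative combination of \<open>1 / z\<close>,
  \<open>(1 - z) / z = 1 / z - 1\<close> and \<open>(1 - z)^2 / z = 1 / z + z - 2\<close>; for each
  of these the imaginary part times \<open>Im z\<close> is at most 0 in the disc.\<close>

lemma Im_cone_product:
  fixes z :: complex and p1 q1 p2 q2 :: real
  assumes "norm z < 1" "z \<noteq> 0" and nonneg: "p1 \<ge> 0" "q1 \<ge> 0" "p2 \<ge> 0" "q2 \<ge> 0"
  shows "Im z * Im ((of_real p1 + of_real q1 * (1 - z)) * (of_real p2 + of_real q2 * (1 - z)) / z) \<le> 0"
proof -
  have Im1: "Im z * Im (1 / z) \<le> 0"
    by (simp add: Im_divide divide_nonpos_nonneg)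
  have "Im (1 / z) = - Im z / (norm z)\<^sup>2"
    by (simp add: Im_divide cmod_power2)
  then have "Im z * Im (1 / z + z) = (Im z)\<^sup>2 * (1 - 1 / (norm z)\<^sup>2)"
    by (simp add: power2_eq_square algebra_simps)
  also have "\<dots> \<le> 0"
    using assms(1,2) by (intro mult_nonneg_nonpos) (simp_all add: power_le_one)
  finally have Im2: "Im z * Im (1 / z + z) \<le> 0" .
  have "(of_real p1 + of_real q1 * (1 - z)) * (of_real p2 + of_real q2 * (1 - z)) / z =
      of_real (p1 * p2 + p1 * q2 + p2 * q1) * (1 / z) - of_real (p1 * q2 + p2 * q1)
      + of_real (q1 * q2) * (1 / z + z - 2)"
    using assms(2) by (simp add: field_simps)
  then have "Im z * Im ((of_real p1 + of_real q1 * (1 - z)) * (of_real p2 + of_real q2 * (1 - z)) / z) =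
      (p1 * p2 + p1 * q2 + p2 * q1) * (Im z * Im (1 / z)) + q1 * q2 * (Im z * Im (1 / z + z))"
    by (simp only: Im_complex_of_real minus_complex.sel plus_complex.sel times_complex.sel Re_complex_of_real complex_Im_numeral)
      (simp add: algebra_simps)
  also have "\<dots> \<le> 0"
    using nonneg by (intro add_nonpos_nonpos mult_nonneg_nonpos [OF _ Im1] mult_nonneg_nonpos [OF _ Im2]) auto
  finally show ?thesis .
qed

subsection \<open>The hypergeometric equation\<close>

lemma eval_fps_real:
  fixes f :: "complex fps"
  assumes "\<And>n. fps_nth f n \<in> \<real>" "z \<in> \<real>" "ereal (norm z) < fps_conv_radius f"
  shows "eval_fps f z \<in> \<real>"
proof -
  have sums: "(\<lambda>n. fps_nth f n * z ^ n) sums eval_fps f z"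
    using assms(3) by (rule sums_eval_fps)
  moreover have "cnj (fps_nth f n * z ^ n) = fps_nth f n * z ^ n" for n
    using assms(1,2) by (simp add: Reals_cnj_iff)
  ultimately have "(\<lambda>n. fps_nth f n * z ^ n) sums cnj (eval_fps f z)"
    by (metis (no_types, lifting) sums_cnj sums_cong)
  then show ?thesis
    using sums sums_unique2 by (auto simp: Reals_cnj_iff)
qed

locale hyp_ratio_params =
  fixes a b :: real
  assumes a_pos: "0 < a" and a_le_b: "a \<le> b" and ab_le: "a + b \<le> 1 / 2"
begin

section \<open>Coefficients of the series, and absence of zeros of \<open>F\<close>\<close>

lemma b_pos: "0 < b" using a_pos a_le_b by simp
lemma b_less: "b < 1 / 2" using a_pos ab_le by simp
lemma a_le: "a \<le> 1 / 4" using a_le_b ab_le by simp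

text \<open>The square comes from the third parameter 1, as
  \<open>pochhammer 1 n = fact n\<close>.\<close>

definition coef :: "nat \<Rightarrow> real" where
  "coef n = pochhammer a n * pochhammer b n / (fact n)\<^sup>2"

lemma coef_0 [simp]: "coef 0 = 1" and coef_1 [simp]: "coef (Suc 0) = a * b"
  by (simp_all add: coef_def)

lemma coef_nonneg: "coef n \<ge> 0"
  using a_pos b_pos by (simp add: coef_def pochhammer_nonneg)

lemma coef_Suc: "(1 + real n)\<^sup>2 * coef (Suc n) = (a + n) * (b + n) * coef n"
  by (simp add: coef_def pochhammer_Suc power_mult_distrib mult_ac del: of_nat_Suc)
    (simp add: add.commute)

text \<open>Telescoping: with \<open>m = n + 1\<close> the step needs
  \<open>(1 + m) * coef (m + 1) \<le> (m - 3/16) * coef m\<close>, which the recursion reduces to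
  \<open>(a + m) * (b + m) \<le> (m - 3/16) * (1 + m)\<close>. The constant 3/16 is the largest that
  \<open>a * b \<le> 1/8\<close> and \<open>a + b \<le> 1/2\<close> allow at
  \<open>m = 1\<close>.\<close>

lemma sum_coef_le: "(\<Sum>k\<in>{1..n}. coef k) \<le> 16 / 3 * (a * b - (1 + real n) * coef (Suc n))"
proof (induction n)
  case (Suc n)
  define m where "m = real (Suc n)"
  have m: "m \<ge> 1" by (simp add: m_def)
  have rec: "(1 + m) * ((1 + m) * coef (Suc (Suc n))) = (a + m) * (b + m) * coef (Suc n)"
    using coef_Suc [of "Suc n"] by (simp add: m_def power2_eq_square)
  have "a * b \<le> 1/4 * (1/2)"
    using a_pos a_le b_pos b_less by (intro mult_mono) auto
  then have "a * b \<le> 1/8" by simp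
  moreover have "(a + b) * m \<le> m / 2"
    using mult_right_mono [OF ab_le, of m] m by simp
  moreover have "p + q \<le> m - (3 + 3 * m) / 16" if "p \<le> 1/8" "q \<le> m / 2" for p q
    using that m by argo
  ultimately have "a * b + (a + b) * m \<le> m - (3 + 3 * m) / 16"
    by blast
  moreover have "(a + m) * (b + m) = a * b + (a + b) * m + m * m" "m * (1 + m) = m + m * m"
    by (simp_all add: algebra_simps)
  ultimately have "(a + m) * (b + m) \<le> m * (1 + m) - (3 + 3 * m) / 16"
    by argo
  also have "\<dots> = (m - 3/16) * (1 + m)"
    by (simp add: field_simps)
  finally have "(a + m) * (b + m) \<le> (m - 3/16) * (1 + m)" .
  from mult_right_mono [OF this coef_nonneg [of "Suc n"]]
  have "(1 + m) * ((1 + m) * coef (Suc (Suc n))) \<le> (1 + m) * ((m - 3/16) * coef (Suc n))"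
    unfolding rec by (simp only: mult_ac)
  then have "(1 + m) * coef (Suc (Suc n)) \<le> (m - 3/16) * coef (Suc n)"
    using m by simp
  then show ?case
    using Suc by (simp add: m_def algebra_simps)
qed simp

lemma sum_coef_less: "(\<Sum>k\<in>{1..n}. coef k) \<le> 2/3"
proof -
  have "a * b \<le> 1/4 * (1/2)"
    using a_pos a_le b_pos b_less by (intro mult_mono) auto
  moreover have "(1 + real n) * coef (Suc n) \<ge> 0"
    using coef_nonneg by simp
  ultimately show ?thesis using sum_coef_le [of n] by simp
qed

lemma summable_coef: "summable coef" and suminf_coef: "(\<Sum>n. coef n) \<le> 5/3"
proof -
  have bound: "(\<Sum>k<n. coef k) \<le> 5/3" for n
  proof -
    have "(\<Sum>k<n. coef k) \<le> (\<Sum>k\<in>insert 0 {1..n}. coef k)"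
      by (intro sum_mono2) (auto simp: coef_nonneg)
    also have "\<dots> \<le> 5/3"
      using sum_coef_less [of n] by simp
    finally show ?thesis .
  qed
  show "summable coef"
    using bound coef_nonneg by (rule summableI_nonneg_bounded [rotated])
  then show "(\<Sum>n. coef n) \<le> 5/3"
    using bound by (rule suminf_le_const)
qed

definition F_fps :: "complex fps" where "F_fps = Abs_fps (\<lambda>n. of_real (coef n))"

definition F :: "complex \<Rightarrow> complex" where "F = eval_fps F_fps"

lemma conv_radius_F: "fps_conv_radius F_fps \<ge> 1"
proof -
  have "conv_radius (\<lambda>n. complex_of_real (coef n)) \<ge> norm (1 :: complex)"
    by (rule conv_radius_geI) (simp add: summable_of_real summable_coef)
  then show ?thesis
    by (simp add: fps_conv_radius_def F_fps_def one_ereal_def)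
qed

lemma in_conv_radius:
  assumes "norm z < 1" shows "ereal (norm z) < fps_conv_radius F_fps"
  using conv_radius_F assms by (metis ereal_less(3) less_le_trans)

lemma F_eq: "hyp2F1 (of_real a) (of_real b) 1 z = F z"
  by (simp add: hyp2F1_def F_def eval_fps_def F_fps_def coef_def pochhammer_of_real
      power2_eq_square flip: pochhammer_fact)

lemma F_holo: "F holomorphic_on ball 0 1"
  unfolding F_def using in_conv_radius
  by (intro holomorphic_on_eval_fps) auto

lemma F_0: "F 0 = 1"
  by (simp add: F_def eval_fps_at_0 F_fps_def)

lemma deriv_F: "norm z < 1 \<Longrightarrow> deriv F z = eval_fps (fps_deriv F_fps) z"
  unfolding F_def using in_conv_radius
  by (intro DERIV_imp_deriv has_field_derivative_eval_fps) auto

lemma deriv_F_0: "deriv F 0 = of_real (a * b)"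
  by (simp add: deriv_F eval_fps_at_0 F_fps_def)

text \<open>The bound 5/3 on the sum of the coefficients gives
  \<open>norm (F z - 1) \<le> 2/3\<close>.\<close>

lemma F_nonzero:
  assumes "norm z < 1"
  shows "F z \<noteq> 0"
proof -
  have sums: "(\<lambda>n. of_real (coef n) * z ^ n) sums F z"
    using sums_eval_fps [OF in_conv_radius [OF assms]] by (simp add: F_def F_fps_def)
  then have "(\<lambda>n. of_real (coef (Suc n)) * z ^ Suc n) sums (F z - 1)"
    by (subst sums_Suc_iff) simp
  moreover have "(\<lambda>n. coef (Suc n)) sums ((\<Sum>n. coef n) - 1)"
    using summable_coef by (subst sums_Suc_iff) (simp add: summable_sums)
  moreover have "norm (of_real (coef (Suc n)) * z ^ Suc n) \<le> coef (Suc n)" for n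
    using assms coef_nonneg [of "Suc n"]
    by (simp add: norm_mult norm_power mult_left_le power_le_one mult_le_one del: power_Suc)
  ultimately have "norm (F z - 1) \<le> (\<Sum>n. coef n) - 1"
    by (metis (no_types, lifting) norm_suminf_le sums_iff)
  then have "norm (F z - 1) < 1"
    using suminf_coef by simp
  then show ?thesis by auto
qed

text \<open>Since \<open>pochhammer (a + 1) n = pochhammer a n * (a + n) / a\<close>, raising
  \<open>a\<close> by 1 acts on the series as \<open>1 + (z / a) d/dz\<close>.\<close>

lemma hyp_ratio_eq:
  assumes "norm z < 1"
  shows "hyp_ratio (of_real a) (of_real b) 1 z = 1 + z * deriv F z / (of_real a * F z)"
proof -
  let ?g = "fps_const (1 / of_real a) * (fps_X * fps_deriv F_fps)"
  have r: "fps_conv_radius (fps_deriv F_fps) \<ge> 1"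
    using conv_radius_F fps_conv_radius_deriv order_trans by blast
  then have r': "fps_conv_radius (fps_X * fps_deriv F_fps) \<ge> 1"
    using fps_conv_radius_mult [of fps_X "fps_deriv F_fps"] by (simp add: min_def split: if_splits)
  have less: "ereal (norm z) < R" if "R \<ge> 1" for R
    using that assms by (metis ereal_less(3) less_le_trans)
  have "pochhammer (complex_of_real a + 1) n = pochhammer (of_real a) n * (of_real a + of_nat n) / of_real a" for n
    using a_pos pochhammer_rec [of "complex_of_real a" n] by (simp add: pochhammer_Suc field_simps)
  moreover have "fps_nth (F_fps + ?g) n = of_real (coef n) * ((of_real a + of_nat n) / of_real a)" for n
    using a_pos by (cases n) (simp_all add: F_fps_def field_simps)
  ultimately have coef': "pochhammer (complex_of_real a + 1) n * pochhammer (of_real b) n / (pochhammer 1 n * fact n)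
      = fps_nth (F_fps + ?g) n" for n
    by (simp add: coef_def pochhammer_of_real power2_eq_square mult_ac flip: pochhammer_fact)
  have "hyp2F1 (of_real a + 1) (of_real b) 1 z = eval_fps (F_fps + ?g) z"
    unfolding hyp2F1_def eval_fps_def coef' ..
  also have "\<dots> = F z + 1 / of_real a * (z * deriv F z)"
    using a_pos assms less r r' conv_radius_F
    by (subst eval_fps_add eval_fps_mult; simp add: fps_conv_radius_cmult_left)+
      (simp add: deriv_F flip: F_def)
  finally show ?thesis
    using F_nonzero [OF assms] a_pos by (simp add: hyp_ratio_def F_eq field_simps)
qed

section \<open>Second-order equation for \<open>F\<close>, and reality on the real axis\<close>

lemma conv_radius_deriv_F: "fps_conv_radius (fps_deriv F_fps) \<ge> 1"
  using conv_radius_F fps_conv_radius_deriv order_trans by blast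

lemma deriv_deriv_F:
  assumes "norm z < 1"
  shows "deriv (deriv F) z = eval_fps (fps_deriv (fps_deriv F_fps)) z"
proof -
  have "(eval_fps (fps_deriv F_fps) has_field_derivative eval_fps (fps_deriv (fps_deriv F_fps)) z) (at z)"
    using conv_radius_deriv_F assms
    by (intro has_field_derivative_eval_fps) (metis ereal_less(3) less_le_trans in_eball_iff dist_0_norm)
  then have "(deriv F has_field_derivative eval_fps (fps_deriv (fps_deriv F_fps)) z) (at z)"
    by (rule has_field_derivative_transform_within_open [of _ _ _ "ball 0 1"])
      (use assms in \<open>auto simp: deriv_F\<close>)
  then show ?thesis by (rule DERIV_imp_deriv)
qed

text \<open>Comparison of coefficients: \<open>F' + z F'' = (z F')'\<close> has coefficients
  \<open>(1 + n)^2 * coef (Suc n)\<close>, and the factor \<open>(a + n) * (b + n)\<close> in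
  \<open>coef_Suc\<close> expands to \<open>n^2 + (a + b) * n + a * b\<close>.\<close>

lemma F_ode:
  assumes "norm z < 1"
  shows "(1 - z) * (deriv F z + z * deriv (deriv F) z) =
    of_real (a + b) * (z * deriv F z) + of_real (a * b) * F z"
proof -
  define D where "D = fps_deriv F_fps"
  define D2 where "D2 = fps_deriv D"
  have nth: "fps_nth (fps_X * H) n = (if n = 0 then 0 else fps_nth H (n - 1))" for H :: "complex fps" and n
    by simp
  have U: "fps_nth (D + fps_X * D2) n = of_real ((1 + real n)\<^sup>2 * coef (Suc n))" for n
    by (cases n) (simp_all add: D_def D2_def F_fps_def power2_eq_square algebra_simps)
  have "D + fps_X * D2 = fps_X * (D + fps_X * D2) + fps_const (of_real (a + b)) * (fps_X * D)
      + fps_const (of_real (a * b)) * F_fps" (is "?L = ?R")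
  proof (rule fps_ext)
    fix n
    have XU: "fps_nth (fps_X * (D + fps_X * D2)) n = of_real ((real n)\<^sup>2 * coef n)"
      unfolding nth U by (cases n) simp_all
    have XD: "fps_nth (fps_X * D) n = of_real (real n * coef n)"
      by (cases n) (simp_all add: D_def F_fps_def)
    show "fps_nth ?L n = fps_nth ?R n"
      unfolding fps_add_nth [of "_ + _"] fps_add_nth [of "fps_X * (D + fps_X * D2)"] U XU
        fps_mult_left_const_nth XD
      unfolding coef_Suc
      by (simp add: F_fps_def algebra_simps power2_eq_square flip: of_real_mult of_real_add)
  qed
  then have eq: "eval_fps ?L z = eval_fps ?R z" by simp
  have rD: "ereal (norm z) < fps_conv_radius D"
    using conv_radius_deriv_F assms unfolding D_def by (metis ereal_less(3) less_le_trans)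
  have rD2: "ereal (norm z) < fps_conv_radius D2"
    using rD fps_conv_radius_deriv [of D] unfolding D2_def by order
  have mult: "eval_fps (fps_X * H) z = z * eval_fps H z \<and> ereal (norm z) < fps_conv_radius (fps_X * H)"
    if "ereal (norm z) < fps_conv_radius H" for H
    using that fps_conv_radius_mult [of fps_X H] by (auto simp: eval_fps_mult)
  have cmult: "eval_fps (fps_const c * H) z = c * eval_fps H z \<and> ereal (norm z) < fps_conv_radius (fps_const c * H)"
    if "ereal (norm z) < fps_conv_radius H" for H c
    using that fps_conv_radius_mult [of "fps_const c" H] by (auto simp: eval_fps_mult)
  have add: "eval_fps (H + H') z = eval_fps H z + eval_fps H' z \<and> ereal (norm z) < fps_conv_radius (H + H')"
    if "ereal (norm z) < fps_conv_radius H" "ereal (norm z) < fps_conv_radius H'" for H H'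
    using that fps_conv_radius_add [of H H'] by (metis eval_fps_add less_le_trans min_less_iff_conj)
  have "eval_fps D z + z * eval_fps D2 z = z * (eval_fps D z + z * eval_fps D2 z)
      + of_real (a + b) * (z * eval_fps D z) + of_real (a * b) * F z"
    using eq rD rD2 in_conv_radius [OF assms] by (simp add: add mult cmult F_def)
  moreover have "(1 - z) * u = v + v'" if "u = z * u + v + v'" for u v v' :: complex
  proof -
    have "u - z * u = v + v'"
      by (subst that) simp
    then show ?thesis by (simp add: left_diff_distrib)
  qed
  ultimately show ?thesis
    unfolding deriv_F [OF assms] deriv_deriv_F [OF assms] D_def [symmetric] D2_def [symmetric]
    by blast
qed

lemma F_real:
  assumes "norm z < 1" "z \<in> \<real>"
  shows "F z \<in> \<real>" "deriv F z \<in> \<real>"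
proof -
  show "F z \<in> \<real>"
    unfolding F_def using assms in_conv_radius by (intro eval_fps_real) (auto simp: F_fps_def)
  show "deriv F z \<in> \<real>"
    unfolding deriv_F [OF assms(1)]
  proof (rule eval_fps_real)
    show "ereal (norm z) < fps_conv_radius (fps_deriv F_fps)"
      using conv_radius_deriv_F assms by (metis ereal_less(3) less_le_trans)
  qed (use assms in \<open>simp_all add: F_fps_def\<close>)
qed


subsection \<open>Riccati equations\<close>

text \<open>Away from 0 this is \<open>(w z - 1) / z\<close>; the form chosen is regular at 0 as
  well.\<close>

definition s :: "complex \<Rightarrow> complex" where "s z = deriv F z / (of_real a * F z)"
definition w :: "complex \<Rightarrow> complex" where "w z = 1 + z * s z"

lemma hyp_ratio_eq_w: "norm z < 1 \<Longrightarrow> hyp_ratio (of_real a) (of_real b) 1 z = w z"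
  by (simp add: hyp_ratio_eq w_def s_def)

lemma s_holo: "s holomorphic_on ball 0 1"
  unfolding s_def using F_holo F_nonzero a_pos
  by (intro holomorphic_intros) auto

lemma w_holo: "w holomorphic_on ball 0 1"
  unfolding w_def using s_holo by (intro holomorphic_intros) auto

lemma s_0: "s 0 = of_real b"
  using a_pos by (simp add: s_def deriv_F_0 F_0)

lemma w_0: "w 0 = 1"
  by (simp add: w_def)

lemma s_deriv: "norm z < 1 \<Longrightarrow> (s has_field_derivative deriv s z) (at z)"
  using s_holo by (simp add: holomorphic_derivI)

lemma deriv_w: "norm z < 1 \<Longrightarrow> deriv w z = s z + z * deriv s z"
  unfolding w_def
  by (rule DERIV_imp_deriv) (rule derivative_eq_intros s_deriv refl | simp)+

text \<open>Differentiate \<open>w - 1 = z F' / (a F)\<close> and eliminate \<open>F''\<close> by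
  the equation of \<open>F\<close>.\<close>

lemma w_ode:
  assumes "norm z < 1"
  shows "(1 - z) * deriv w z =
    of_real b + of_real (a + b) * (z * s z) - of_real a * (1 - z) * (z * (s z)\<^sup>2)"
proof -
  define f f1 f2 where "f = F z" "f1 = deriv F z" "f2 = deriv (deriv F) z"
  have [simp]: "f \<noteq> 0" using F_nonzero assms by (simp add: f_f1_f2_def)
  have [simp]: "a \<noteq> 0" using a_pos by simp
  have "(F has_field_derivative f1) (at z)" "(deriv F has_field_derivative f2) (at z)"
    unfolding f_f1_f2_def using F_holo assms
    by (auto intro!: holomorphic_derivI holomorphic_deriv)
  then have "(s has_field_derivative (f2 * (of_real a * F z) - deriv F z * (of_real a * f1)) / (of_real a * F z * (of_real a * F z))) (at z)"
    unfolding s_def using F_nonzero assms by (intro DERIV_divide DERIV_cmult) auto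
  then have ds: "deriv s z = (f2 * f - f1 * f1) / (of_real a * f\<^sup>2)"
    by (intro DERIV_imp_deriv, elim DERIV_cong)
      (simp add: f_f1_f2_def(1,2) [symmetric] power2_eq_square divide_simps, simp add: algebra_simps)
  have "(1 - z) * deriv w z = ((1 - z) * (f1 + z * f2) * f - (1 - z) * z * f1\<^sup>2) / (of_real a * f\<^sup>2)"
    unfolding deriv_w [OF assms] ds s_def f_f1_f2_def(1,2) [symmetric]
    by (simp add: power2_eq_square divide_simps) (simp add: algebra_simps)
  also have "(1 - z) * (f1 + z * f2) = of_real (a + b) * (z * f1) + of_real (a * b) * f"
    using F_ode [OF assms] by (simp add: f_f1_f2_def)
  also have "((of_real (a + b) * (z * f1) + of_real (a * b) * f) * f - (1 - z) * z * f1\<^sup>2) / (of_real a * f\<^sup>2)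
      = of_real b + of_real (a + b) * (z * s z) - of_real a * (1 - z) * (z * (s z)\<^sup>2)"
    unfolding s_def f_f1_f2_def(1,2) [symmetric]
    by (simp add: power2_eq_square field_simps)
  finally show ?thesis .
qed

lemma Re_w:
  assumes "norm z < 1"
  shows "Re (w z) > 1 / (1 + b)"
proof -
  \<comment> \<open>\<open>\<beta>\<close> is the distance from \<open>w 0 = 1\<close> to the
    claimed bound, hence the initial value in the half-plane criterion.\<close>
  define \<beta> where "\<beta> = b / (1 + b)"
  have \<beta>: "0 < \<beta>" "\<beta> < 1 / 2" "1 / (1 + b) = 1 - \<beta>" "b - (a + b) * \<beta> = \<beta> * (1 - a)"
    using b_pos b_less by (auto simp: \<beta>_def field_simps)
  have "Re (w z - of_real (1 - \<beta>)) > 0"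
  proof (rule Re_pos_if_no_first_exit [OF _ _ \<beta>(1) _ assms])
    show "(\<lambda>z. w z - of_real (1 - \<beta>)) holomorphic_on ball 0 1"
      using w_holo by (intro holomorphic_intros)
    show "w 0 - of_real (1 - \<beta>) = of_real \<beta>"
      by (simp add: w_0)
  next
    fix z \<sigma> \<eta>
    assume z: "norm z < 1" and exit: "w z - of_real (1 - \<beta>) = \<i> * of_real \<eta>"
      and "z * deriv (\<lambda>z. w z - of_real (1 - \<beta>)) z = - of_real \<sigma>"
      and \<sigma>: "(\<beta>\<^sup>2 + \<eta>\<^sup>2) / (2 * \<beta>) \<le> \<sigma>"
    moreover have "deriv (\<lambda>z. w z - of_real (1 - \<beta>)) z = deriv w z"
      using w_holo z
      by (intro DERIV_imp_deriv) (auto intro!: derivative_eq_intros holomorphic_derivI)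
    ultimately have dw: "z * deriv w z = - of_real \<sigma>" by simp
    define g where "g = - of_real \<beta> + \<i> * of_real \<eta>"
    have g: "z * s z = g"
      using exit by (simp add: w_def g_def algebra_simps)
    show False
    proof (rule no_disc_solution [OF z])
      \<comment> \<open>The factor \<open>z\<close> makes \<open>z * s z\<close>, known at the exit
        point, the only unknown function on the right.\<close>
      have "(1 - z) * (z * deriv w z) = z * ((1 - z) * deriv w z)"
        by simp
      also have "\<dots> = z * (of_real b + of_real (a + b) * (z * s z)) - of_real a * (1 - z) * (z * s z)\<^sup>2"
        unfolding w_ode [OF z] by (simp add: power2_eq_square algebra_simps)
      finally have "(1 - z) * (z * deriv w z) =
          z * (of_real b + of_real (a + b) * (z * s z)) - of_real a * (1 - z) * (z * s z)\<^sup>2" .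
      then show "(1 - z) * (- of_real \<sigma> + of_real a * g\<^sup>2) = z * (of_real b + of_real (a + b) * g)"
        unfolding dw g by (simp add: algebra_simps)
      \<comment> \<open>Eliminating \<open>\<sigma>\<close> bounds the expression by
        \<open>- a * (1 - a) * \<beta>^2 * (1 - 2 * \<beta>)\<close>, negative since
        \<open>\<beta> < 1/2\<close>, plus a nonpositive multiple of
        \<open>\<eta>^2\<close>.\<close>
      have "2 * \<beta> * \<sigma> \<ge> \<beta>\<^sup>2 + \<eta>\<^sup>2"
        using \<sigma> \<beta> by (simp add: field_simps)
      then have "(1 - a) * (2 * \<beta> * \<sigma>) \<ge> (1 - a) * (\<beta>\<^sup>2 + \<eta>\<^sup>2)"
        using a_le by (intro mult_left_mono) auto
      moreover have "(1 - a) * a * \<beta>\<^sup>2 * (1 - 2 * \<beta>) > 0"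
        using a_pos a_le \<beta>(1,2) by (intro mult_pos_pos) auto
      moreover have "(1 - a) * a * \<beta> * \<eta>\<^sup>2 \<ge> 0" "a * \<beta> * (a + b) * \<eta>\<^sup>2 \<ge> 0"
        using a_pos a_le \<beta>(1,2) b_pos by (intro mult_nonneg_nonneg; simp)+
      moreover have "(a + b)\<^sup>2 * \<eta>\<^sup>2 \<le> (1 - a) * \<eta>\<^sup>2"
      proof (rule mult_right_mono)
        have "(a + b)\<^sup>2 \<le> (1/2)\<^sup>2"
          using ab_le a_pos b_pos by (intro power_mono) auto
        then show "(a + b)\<^sup>2 \<le> 1 - a" using a_le by (simp add: power2_eq_square)
      qed simp
      ultimately have "(\<beta> * (1 - a))\<^sup>2 + ((a + b) * \<eta>)\<^sup>2 + 2 * ((- \<sigma> + a * (\<beta>\<^sup>2 - \<eta>\<^sup>2)) * (\<beta> * (1 - a))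
          + (- 2 * a * \<beta> * \<eta>) * ((a + b) * \<eta>)) < 0"
        by (simp add: power2_eq_square algebra_simps)
      moreover have "Re (of_real b + of_real (a + b) * g) = \<beta> * (1 - a)"
        using \<beta>(4) by (simp add: g_def)
      moreover have "Im (of_real b + of_real (a + b) * g) = (a + b) * \<eta>"
        "Re (- of_real \<sigma> + of_real a * g\<^sup>2) = - \<sigma> + a * (\<beta>\<^sup>2 - \<eta>\<^sup>2)"
        "Im (- of_real \<sigma> + of_real a * g\<^sup>2) = - 2 * a * \<beta> * \<eta>"
        by (simp_all add: g_def power2_eq_square algebra_simps)
      ultimately show "(Re (of_real b + of_real (a + b) * g))\<^sup>2 + (Im (of_real b + of_real (a + b) * g))\<^sup>2
          + 2 * (Re (- of_real \<sigma> + of_real a * g\<^sup>2) * Re (of_real b + of_real (a + b) * g)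
            + Im (- of_real \<sigma> + of_real a * g\<^sup>2) * Im (of_real b + of_real (a + b) * g)) < 0"
        by (simp only:)
    qed
  qed
  then show ?thesis using \<beta>(3) by simp
qed

lemma Re_w_half: "norm z < 1 \<Longrightarrow> Re (w z) > 1 / 2"
  by (rule order.strict_trans [OF _ Re_w]) (use b_pos b_less in \<open>auto simp: field_simps\<close>)

lemma w_nonzero: "norm z < 1 \<Longrightarrow> w z \<noteq> 0"
  using Re_w_half [of z] by auto

section \<open>The function \<open>y\<close>: real part and sign of the imaginary part\<close>

definition y :: "complex \<Rightarrow> complex" where "y z = (1 - z) * s z"

lemma y_holo: "y holomorphic_on ball 0 1"
  unfolding y_def using s_holo by (intro holomorphic_intros)

lemma y_0: "y 0 = of_real b"
  by (simp add: y_def s_0)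

text \<open>The left side is the derivative of \<open>z * y z = (1 - z) * (w z - 1)\<close>, so the
  equation of \<open>w\<close> applies.\<close>

lemma y_ode:
  assumes "norm z < 1"
  shows "y z + z * deriv y z = of_real b - z / (1 - z) * (y z * (of_real a * y z + of_real (1 - a - b)))"
proof -
  have [simp]: "z \<noteq> 1" using assms by auto
  have dy: "deriv y z = (1 - z) * deriv s z - s z"
  proof (rule DERIV_imp_deriv)
    have "(y has_field_derivative (0 - 1) * s z + deriv s z * (1 - z)) (at z)"
      unfolding y_def using assms
      by (intro DERIV_mult DERIV_diff DERIV_const DERIV_ident s_deriv)
    then show "(y has_field_derivative (1 - z) * deriv s z - s z) (at z)"
      by (rule DERIV_cong) (simp add: algebra_simps)
  qed
  have lhs: "y z + z * deriv y z = (1 - z) * deriv w z - z * s z"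
    unfolding dy deriv_w [OF assms] y_def by (simp add: algebra_simps)
  have rhs: "z / (1 - z) * (y z * c) = z * s z * c" for c
    by (simp add: y_def)
  show ?thesis
    unfolding lhs rhs w_ode [OF assms] by (simp add: y_def algebra_simps power2_eq_square)
qed

lemma Re_y:
  assumes "norm z < 1"
  shows "Re (y z) > 0"
proof (rule Re_pos_if_no_first_exit [OF y_holo y_0 b_pos _ assms])
  fix z \<sigma> \<eta>
  assume z: "norm z < 1" and exit: "y z = \<i> * of_real \<eta>" and dy: "z * deriv y z = - of_real \<sigma>"
    and \<sigma>: "(b\<^sup>2 + \<eta>\<^sup>2) / (2 * b) \<le> \<sigma>"
  have [simp]: "z \<noteq> 1" using z by auto
  define m where "m = 1 - a - b"
  have m: "0 < m" "m < 1" using a_pos b_pos ab_le by (auto simp: m_def)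
  have "\<sigma> \<ge> 0"
    by (rule order_trans [OF _ \<sigma>]) (use b_pos in simp)
  define U where "U = of_real (b + \<sigma>) - \<i> * of_real \<eta>"
  define V where "V = \<i> * of_real \<eta> * (of_real a * (\<i> * of_real \<eta>) + of_real m)"
  have eq: "(1 - z) * U = z * V"
    using y_ode [OF z] unfolding dy exit m_def [symmetric] U_def V_def by (simp add: field_simps)
  show False
  \<comment> \<open>For \<open>\<eta> = 0\<close> also \<open>V = 0\<close>, and the strict
    inequality degenerates; but then \<open>U = b + \<sigma> > 0\<close> contradicts the
    equation.\<close>
  proof (cases "\<eta> = 0")
    case True
    then have "U = 0" using eq by (simp add: V_def)
    then show False using True \<open>\<sigma> \<ge> 0\<close> b_pos by (auto simp: U_def simp flip: of_real_add)
  next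
    case False
    have "2 * b * \<sigma> \<ge> b\<^sup>2 + \<eta>\<^sup>2"
      using \<sigma> b_pos by (simp add: field_simps)
    then have "2 * b * \<sigma> \<ge> \<eta>\<^sup>2"
      by (rule order_trans [rotated]) simp
    then have "a * \<eta>\<^sup>2 \<le> a * (2 * b * \<sigma>)"
      using a_pos by (intro mult_left_mono) auto
    also have "\<dots> \<le> \<sigma>"
    proof -
      have "2 * b * a \<le> 1 * 1"
        using b_less a_le a_pos b_pos by (intro mult_mono) auto
      then have "2 * b * a * \<sigma> \<le> 1 * \<sigma>"
        using \<open>\<sigma> \<ge> 0\<close> by (intro mult_right_mono) auto
      then show ?thesis by (simp add: mult_ac)
    qed
    finally have "a * \<eta>\<^sup>2 \<le> \<sigma>" .
    \<comment> \<open>The term \<open>a^2 * \<eta>^4\<close> is absorbed by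
      \<open>2 * \<sigma> * a * \<eta>^2\<close>, and \<open>m^2 * \<eta>^2\<close> by
      \<open>2 * m * \<eta>^2\<close>.\<close>
    then have "a * \<eta>\<^sup>2 * (a * \<eta>\<^sup>2) \<le> \<sigma> * (a * \<eta>\<^sup>2)"
      using a_pos by (intro mult_right_mono) auto
    moreover have "0 \<le> \<sigma> * (a * \<eta>\<^sup>2)" "0 < b * (a * \<eta>\<^sup>2)"
      using \<open>\<sigma> \<ge> 0\<close> a_pos b_pos False by simp_all
    moreover have "m * (m * \<eta>\<^sup>2) < 1 * (m * \<eta>\<^sup>2)"
      using m False by (intro mult_strict_right_mono) auto
    moreover have "0 < m * \<eta>\<^sup>2" using m False by simp
    ultimately have "(Re V)\<^sup>2 + (Im V)\<^sup>2 + 2 * (Re U * Re V + Im U * Im V) < 0"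
      by (simp add: U_def V_def power2_eq_square algebra_simps)
    then show False using no_disc_solution [OF z eq] by blast
  qed
qed

text \<open>The ray criterion applies to \<open>- y\<close>: where \<open>y\<close> is real it is
  positive by \<open>Re_y\<close>, and so is \<open>y * (a * y + 1 - a - b)\<close>.\<close>

lemma Im_y:
  assumes "norm z < 1" "Im z \<noteq> 0"
  shows "Im z * Im (y z) < 0"
proof -
  have "Im z * Im (- y z) > 0"
  proof (rule Im_pos_along_rays [where q = "\<lambda>z. y z * (of_real a * y z + of_real (1 - a - b))"
        and c = "- b" and f = "\<lambda>z. - y z" and ?q0.0 = "b * (a * b + (1 - a - b))", OF _ _ _ _ _ _ assms])
    show "(\<lambda>z. - y z) holomorphic_on ball 0 1"
      using y_holo by (intro holomorphic_intros)
    show "- y z + z * deriv (\<lambda>z. - y z) z = of_real (- b) + z / (1 - z) * (y z * (of_real a * y z + of_real (1 - a - b)))"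
      if "norm z < 1" for z
    proof -
      have "deriv (\<lambda>z. - y z) z = - deriv y z"
        using y_holo that by (intro deriv_minus holomorphic_on_imp_differentiable_at) auto
      then show ?thesis using y_ode [OF that] by (simp add: algebra_simps)
    qed
    have "isCont y 0"
    by (rule DERIV_isCont [OF holomorphic_derivI [OF y_holo open_ball]]) simp
    then show "isCont (\<lambda>z. y z * (of_real a * y z + of_real (1 - a - b))) 0"
      by (intro continuous_intros)
    show "y 0 * (of_real a * y 0 + of_real (1 - a - b)) = of_real (b * (a * b + (1 - a - b)))"
      by (simp add: y_0)
    show "0 < b * (a * b + (1 - a - b))"
      using a_pos b_pos ab_le by (intro mult_pos_pos add_pos_pos) auto
    show "Im (y z * (of_real a * y z + of_real (1 - a - b))) = 0 \<and>
        0 < Re (y z * (of_real a * y z + of_real (1 - a - b)))"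
      if "norm z < 1" "Im z \<noteq> 0" "Im (- y z) = 0" for z
      using that Re_y [of z] a_pos ab_le by (simp add: add_pos_pos)
  qed
  then show ?thesis by simp
qed

section \<open>The function \<open>A\<close>: modulus and sign of the imaginary part\<close>

definition A :: "complex \<Rightarrow> complex" where "A z = s z / w z"

lemma A_holo: "A holomorphic_on ball 0 1"
  unfolding A_def using s_holo w_holo w_nonzero by (intro holomorphic_intros) auto

lemma A_0: "A 0 = of_real b"
  by (simp add: A_def s_0 w_0)

text \<open>\<open>z * A z = (w z - 1) / w z\<close> has modulus below 1 because
  \<open>Re w > 1/2\<close>, so Schwarz's lemma gives \<open>norm (A z) \<le> 1\<close> for
  \<open>z \<noteq> 0\<close>. Equality would make the product a rotation, although its derivative
  at 0 is \<open>A 0 = b < 1\<close>.\<close>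

lemma norm_A:
  assumes "norm z < 1"
  shows "norm (A z) < 1"
proof (cases "z = 0")
  case True
  then show ?thesis using A_0 b_less b_pos by simp
next
  case False
  define X where "X z = z * A z" for z
  have X: "X holomorphic_on ball 0 1" "X 0 = 0"
    unfolding X_def using A_holo by (auto intro!: holomorphic_intros)
  have X_less: "norm (X z) < 1" if "norm z < 1" for z
    using norm_ratio_less [OF Re_w_half [OF that]] by (simp add: X_def A_def w_def)
  have "norm (X z) \<noteq> norm z"
  proof
    assume "norm (X z) = norm z"
    then obtain \<alpha> where \<alpha>: "\<And>z. norm z < 1 \<Longrightarrow> X z = \<alpha> * z" "norm \<alpha> = 1"
      using Schwarz_Lemma(3) [OF X X_less, of 0] assms False by auto
    have "(X has_field_derivative \<alpha>) (at 0)"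
      by (rule has_field_derivative_transform_within_open [of "\<lambda>z. \<alpha> * z" _ _ "ball 0 1"])
        (auto intro!: derivative_eq_intros simp: \<alpha>)
    moreover have "(X has_field_derivative 1 * A 0 + deriv A 0 * 0) (at 0)"
      unfolding X_def
      by (rule DERIV_mult [OF DERIV_ident holomorphic_derivI [OF A_holo open_ball]]) simp
    ultimately have "\<alpha> = of_real b"
      using DERIV_unique A_0 by fastforce
    then show False using \<alpha> b_less b_pos by simp
  qed
  then have "norm z * norm (A z) < norm z * 1"
    using Schwarz_Lemma(1) [OF X X_less assms] by (simp add: X_def norm_mult)
  then show ?thesis using False by simp
qed

text \<open>The left side is the derivative of \<open>z * A z = 1 - 1 / w z\<close>, that is,
  \<open>deriv w z / (w z)^2\<close>.\<close>

lemma A_ode: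
  assumes "norm z < 1"
  shows "A z + z * deriv A z = of_real b + z / (1 - z) * ((1 - A z) * (of_real b + of_real a * A z))"
proof -
  have [simp]: "z \<noteq> 1" using assms by auto
  have [simp]: "1 - z \<noteq> 0" by simp
  have wz [simp]: "w z \<noteq> 0" using w_nonzero assms by simp
  have "(A has_field_derivative (deriv s z * w z - s z * deriv w z) / (w z * w z)) (at z)"
    unfolding A_def using w_holo assms
    by (intro DERIV_divide s_deriv holomorphic_derivI [of w "ball 0 1"]) auto
  then have dA: "deriv A z = (deriv s z * w z - s z * deriv w z) / (w z * w z)"
    by (rule DERIV_imp_deriv)
  have "A z + z * deriv A z = (s z + z * deriv s z) * w z / (w z * w z) - z * s z * deriv w z / (w z * w z)"
    unfolding dA A_def by (simp add: field_simps)
  also have "\<dots> = deriv w z * (w z - z * s z) / (w z * w z)"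
    by (simp add: deriv_w assms diff_divide_distrib algebra_simps)
  also have "\<dots> = deriv w z / (w z)\<^sup>2"
    by (simp add: w_def power2_eq_square)
  also have "\<dots> = (1 - z) * deriv w z / ((1 - z) * (w z)\<^sup>2)"
    by simp
  \<comment> \<open>Made homogeneous in \<open>w z\<close> and \<open>s z\<close> by
    \<open>1 = w z - z * s z\<close>, so that dividing by \<open>(w z)^2\<close> leaves only
    \<open>A z\<close>.\<close>
  also have "(1 - z) * deriv w z = (1 - z) * of_real b * (w z)\<^sup>2 + z * ((w z - s z) * (of_real b * w z + of_real a * s z))"
    unfolding w_ode [OF assms] by (simp add: w_def power2_eq_square algebra_simps)
  also have "\<dots> / ((1 - z) * (w z)\<^sup>2) = of_real b + z / (1 - z) * ((1 - A z) * (of_real b + of_real a * A z))"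
    by (simp add: A_def power2_eq_square add_divide_distrib) (simp add: divide_simps)
  finally show ?thesis .
qed

text \<open>Where \<open>A\<close> is real, \<open>norm_A\<close> puts it between -1 and 1; then
  \<open>1 - A > 0\<close>, and \<open>b + a * A > 0\<close> because
  \<open>a \<le> b\<close>.\<close>

lemma Im_A:
  assumes "norm z < 1" "Im z \<noteq> 0"
  shows "Im z * Im (A z) > 0"
proof (rule Im_pos_along_rays [where q = "\<lambda>z. (1 - A z) * (of_real b + of_real a * A z)"
      and c = b and ?q0.0 = "(1 - b) * (b + a * b)", OF A_holo A_ode _ _ _ _ assms])
  have "isCont A 0"
    by (rule DERIV_isCont [OF holomorphic_derivI [OF A_holo open_ball]]) simp
  then show "isCont (\<lambda>z. (1 - A z) * (of_real b + of_real a * A z)) 0"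
    by (intro continuous_intros)
  show "(1 - A 0) * (of_real b + of_real a * A 0) = of_real ((1 - b) * (b + a * b))"
    by (simp add: A_0)
  show "0 < (1 - b) * (b + a * b)"
    using a_pos b_pos b_less by (intro mult_pos_pos add_pos_pos) auto
  show "Im ((1 - A z) * (of_real b + of_real a * A z)) = 0 \<and>
      0 < Re ((1 - A z) * (of_real b + of_real a * A z))"
    if "norm z < 1" "Im z \<noteq> 0" "Im (A z) = 0" for z
  proof -
    have "\<bar>Re (A z)\<bar> < 1"
      using norm_A [OF that(1)] abs_Re_le_cmod [of "A z"] by linarith
    moreover have "a * Re (A z) > - b"
    proof -
      have "a * Re (A z) > a * (- 1)"
        using \<open>\<bar>Re (A z)\<bar> < 1\<close> a_pos by (intro mult_strict_left_mono) auto
      then show ?thesis using a_le_b by simp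
    qed
    ultimately show ?thesis using that(3) by simp
  qed
qed


subsection \<open>The order of convexity\<close>

text \<open>Chosen so that the right side of \<open>w_ode\<close> factors as
  \<open>w * (a * z * s + b) * (1 - Q)\<close>.\<close>

definition Q :: "complex \<Rightarrow> complex" where
  "Q z = of_real a * z * (s z)\<^sup>2 / (w z * (of_real a * (z * s z) + of_real b))"

text \<open>The expression is the ratio with \<open>a\<close> and \<open>b\<close> interchanged.
  Since \<open>a / b \<le> 1\<close>, the bound \<open>Re (z * s z) > - 1/2\<close> survives scaling
  by \<open>a / b\<close>.\<close>

lemma Re_conj_param:
  assumes "norm z < 1"
  shows "Re (of_real 1 + of_real (a / b) * (z * s z)) > 1 / 2"
proof -
  define r where "r = a / b"
  have r: "0 < r" "r \<le> 1"
    using a_pos a_le_b b_pos by (simp_all add: r_def)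
  have "Re (z * s z) + 1 / 2 > 0"
    using Re_w_half [OF assms] by (simp add: w_def)
  then have "r * (Re (z * s z) + 1 / 2) > 0"
    using r by (intro mult_pos_pos)
  then have "1 + r * Re (z * s z) > 1 / 2"
    using r unfolding distrib_left by linarith
  then show ?thesis by (simp add: r_def)
qed

text \<open>With \<open>u = 1 + (a / b) * z * s\<close> one has \<open>a * z * s + b = b * u\<close>
  and \<open>Q = A * ((u - 1) / u)\<close>, where both factors have modulus below 1.\<close>

lemma norm_Q:
  assumes "norm z < 1"
  shows "norm (Q z) < 1" and "of_real a * (z * s z) + of_real b \<noteq> 0"
proof -
  define u where "u = of_real 1 + of_real (a / b) * (z * s z)"
  have u: "Re u > 1 / 2" using Re_conj_param [OF assms] by (simp add: u_def)
  then have "u \<noteq> 0" by auto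
  have bu: "of_real a * (z * s z) + of_real b = of_real b * u"
    using b_pos by (simp add: u_def field_simps)
  then show "of_real a * (z * s z) + of_real b \<noteq> 0"
    using \<open>u \<noteq> 0\<close> b_pos by simp
  have "Q z = A z * ((u - 1) / u)"
    unfolding Q_def A_def bu using b_pos by (simp add: u_def power2_eq_square)
  moreover have "norm (A z) * norm ((u - 1) / u) < 1 * 1"
    using norm_A [OF assms] norm_ratio_less [OF u] by (intro mult_strict_mono) auto
  ultimately show "norm (Q z) < 1" by (simp only: norm_mult mult_1)
qed

lemma s_nonzero: "norm z < 1 \<Longrightarrow> s z \<noteq> 0"
  using Re_y [of z] by (auto simp: y_def)

text \<open>
  Both factors of \<open>1 / Q z = (z + 1 / s z) (z + (b / a) (1 / s z)) / z\<close> lie in the convex cone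
  spanned by \<open>1\<close> and \<open>1 - z\<close>.
\<close>

lemma Im_Q:
  assumes "norm z < 1" "Im z \<noteq> 0"
  shows "Im z * Im (Q z) \<ge> 0"
proof -
  define e where "e = 1 / s z"
  have s: "s z \<noteq> 0" "s z = 1 / e" "e \<noteq> 0" using s_nonzero assms by (auto simp: e_def)
  have z: "z \<noteq> 0" "1 - z \<noteq> 0" using assms by auto
  have wz: "w z \<noteq> 0" using w_nonzero assms by simp
  \<comment> \<open>\<open>u\<close> and \<open>v\<close> are the coordinates of \<open>e\<close> in
    the real basis \<open>1\<close>, \<open>1 - z\<close>.\<close>
  define v where "v = - Im e / Im z"
  define u where "u = Re e - v * (1 - Re z)"
  have e: "e = of_real u + of_real v * (1 - z)"
    using assms by (simp add: complex_eq_iff u_def v_def)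
  \<comment> \<open>\<open>1 / A z = z + e\<close> has imaginary part \<open>(1 - v) * Im z\<close>,
    whose sign is known from \<open>Im_A\<close>.\<close>
  have "v \<ge> 1"
  proof -
    have "w z = (z + e) * s z"
      using s(1) by (simp add: w_def e_def distrib_right)
    then have "1 / A z = z + e"
      using s(1) by (simp add: A_def)
    moreover have "Im z * Im (1 / A z) \<le> 0"
      using Im_A [OF assms] by (simp add: Im_divide divide_nonpos_nonneg)
    ultimately have "Im z * Im z + Im z * Im e \<le> 0"
      by (simp add: algebra_simps)
    moreover have "Im e = - v * Im z" using assms by (simp add: v_def)
    ultimately have "(v - 1) * (Im z)\<^sup>2 \<ge> 0"
      by (simp add: power2_eq_square algebra_simps)
    then show ?thesis using assms by (simp add: zero_le_mult_iff)
  qed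
  \<comment> \<open>In \<open>1 / y z = u / (1 - z) + v\<close> only the first term has an imaginary
    part; its sign comes from \<open>Im_y\<close>.\<close>
  have "u \<ge> 0"
  proof -
    have "1 / y z = e / (1 - z)" using s z by (simp add: y_def)
    also have "\<dots> = of_real u * (1 / (1 - z)) + of_real v"
      unfolding e using z by (simp add: field_simps)
    finally have "Im (1 / y z) = u * Im (1 / (1 - z))"
      by (simp only: plus_complex.sel times_complex.sel Re_complex_of_real Im_complex_of_real)
    also have "Im (1 / (1 - z)) = Im z / (norm (1 - z))\<^sup>2"
      by (simp add: Im_divide cmod_power2)
    finally have "Im z * Im (1 / y z) = u * ((Im z)\<^sup>2 / (norm (1 - z))\<^sup>2)"
      by (simp add: power2_eq_square)
    moreover have "Im z * Im (1 / y z) \<ge> 0"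
      using Im_y [OF assms] by (simp add: Im_divide divide_nonpos_nonneg)
    ultimately show ?thesis
      using assms z by (simp add: zero_le_mult_iff zero_le_divide_iff)
  qed
  define \<mu> where "\<mu> = b / a"
  have "\<mu> \<ge> 1" using a_pos a_le_b by (simp add: \<mu>_def)
  have "1 * 1 \<le> \<mu> * v" using \<open>\<mu> \<ge> 1\<close> \<open>v \<ge> 1\<close> by (intro mult_mono) auto
  have "w z = (z + e) * s z"
    using s(1) by (simp add: w_def e_def distrib_right)
  moreover have "of_real a * (z * s z) + of_real b = of_real a * ((z + of_real \<mu> * e) * s z)"
    using s(1) a_pos by (simp add: \<mu>_def e_def distrib_left distrib_right)
  ultimately have "Q z = (of_real a * (s z)\<^sup>2) * z / ((of_real a * (s z)\<^sup>2) * ((z + e) * (z + of_real \<mu> * e)))"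
    unfolding Q_def by (simp only: power2_eq_square mult_ac)
  then have "1 / Q z = (z + e) * (z + of_real \<mu> * e) / z"
    using s(1) a_pos by simp
  \<comment> \<open>Substituting \<open>z = 1 - (1 - z)\<close> lowers the coefficient of
    \<open>1 - z\<close> by 1, which \<open>v \<ge> 1\<close> and \<open>\<mu> * v \<ge> 1\<close>
    permit.\<close>
  also have "z + e = of_real (u + 1) + of_real (v - 1) * (1 - z)"
    by (simp add: e algebra_simps)
  also have "z + of_real \<mu> * e = of_real (\<mu> * u + 1) + of_real (\<mu> * v - 1) * (1 - z)"
    by (simp add: e algebra_simps)
  finally have "Im z * Im (1 / Q z) \<le> 0"
    using Im_cone_product [OF assms(1) z(1), of "u + 1" "v - 1" "\<mu> * u + 1" "\<mu> * v - 1"]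
      \<open>u \<ge> 0\<close> \<open>v \<ge> 1\<close> \<open>\<mu> \<ge> 1\<close> \<open>1 * 1 \<le> \<mu> * v\<close> by simp
  moreover have "Q z \<noteq> 0"
    using s z wz a_pos norm_Q(2) [OF assms(1)] by (simp add: Q_def)
  moreover have "Im (1 / Q z) = - Im (Q z) / (norm (Q z))\<^sup>2"
    by (simp add: Im_divide cmod_power2)
  ultimately have "0 \<le> Im z * Im (Q z) / (norm (Q z))\<^sup>2"
    by simp
  then show ?thesis
    using \<open>Q z \<noteq> 0\<close> by (simp add: zero_le_divide_iff)
qed

lemma real_axis:
  assumes "norm z < 1" "Im z = 0"
  shows "s z \<in> \<real>"
proof -
  have "z \<in> \<real>" using assms by (simp add: complex_is_Real_iff)
  then show ?thesis
    using F_real [OF assms(1)] by (simp add: s_def)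
qed

lemma Re_quotient_nonneg:
  assumes "norm z < 1"
  shows "Re ((1 - A z + y z) / (1 - Q z)) \<ge> 0"
proof -
  define S where "S = 1 - A z + y z"
  have "\<bar>Re (A z)\<bar> < 1" "\<bar>Re (Q z)\<bar> < 1"
    using norm_A [OF assms] norm_Q(1) [OF assms] abs_Re_le_cmod order_le_less_trans by blast+
  then have Re: "Re S > 0" "Re (1 - Q z) > 0"
    using Re_y [OF assms] by (simp_all add: S_def)
  have "Im S * Im (1 - Q z) \<ge> 0"
  \<comment> \<open>The ray criterion says nothing on the real axis, but there \<open>S\<close> is
    real.\<close>
  proof (cases "Im z = 0")
    case True
    have "Im S = 0"
      using real_axis [OF assms True] True
      by (simp add: S_def A_def y_def w_def complex_is_Real_iff Im_divide)
    then show ?thesis by simp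
  next
    case False
    have "(Im z * Im S) * (Im z * Im (1 - Q z)) \<ge> 0"
      using Im_A [OF assms False] Im_y [OF assms False] Im_Q [OF assms False]
      by (intro mult_nonpos_nonpos) (simp_all add: S_def algebra_simps)
    then have "(Im z)\<^sup>2 * 0 \<le> (Im z)\<^sup>2 * (Im S * Im (1 - Q z))"
      by (simp only: power2_eq_square mult_ac mult_zero_right)
    then show ?thesis by (rule mult_left_le_imp_le) (use False in simp)
  qed
  moreover have "Re S * Re (1 - Q z) > 0" using Re by simp
  ultimately have "Re S * Re (1 - Q z) + Im S * Im (1 - Q z) \<ge> 0"
    by linarith
  then show ?thesis
    unfolding S_def [symmetric] Re_divide by simp
qed

section \<open>Factored equation of \<open>w\<close>, and the quotient
  \<open>z w'' / w'\<close>\<close>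

lemma deriv_w_nonzero:
  assumes "norm z < 1"
  shows "(1 - z) * deriv w z = w z * (of_real a * (z * s z) + of_real b) * (1 - Q z)"
    and "deriv w z \<noteq> 0"
proof -
  have ne: "w z \<noteq> 0" "of_real a * (z * s z) + of_real b \<noteq> 0"
    using w_nonzero norm_Q(2) assms by auto
  have "w z * (of_real a * (z * s z) + of_real b) * (1 - Q z) =
      w z * (of_real a * (z * s z) + of_real b) - of_real a * z * (s z)\<^sup>2"
    using ne by (simp add: Q_def right_diff_distrib)
  also have "\<dots> = (1 - z) * deriv w z"
    unfolding w_ode [OF assms] by (simp add: w_def power2_eq_square algebra_simps)
  finally show *: "(1 - z) * deriv w z = w z * (of_real a * (z * s z) + of_real b) * (1 - Q z)"
    by simp
  have "1 - Q z \<noteq> 0" using norm_Q(1) [OF assms] by auto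
  then show "deriv w z \<noteq> 0" using * ne by auto
qed

lemma second_log_deriv:
  assumes "norm z < 1"
  shows "z * deriv (deriv w) z / deriv w z =
    of_real (1 + a + b) * (z / (1 - z)) - 2 * of_real a * (w z - 1) + Q z / (1 - Q z)"
proof -
  define w1 w2 s1 where "w1 = deriv w z" "w2 = deriv (deriv w) z" "s1 = deriv s z"
  note defs = w1_w2_s1_def
  have [simp]: "z \<noteq> 1" using assms by auto
  have ne: "w z \<noteq> 0" "of_real a * (z * s z) + of_real b \<noteq> 0" "w1 \<noteq> 0" "1 - Q z \<noteq> 0"
    using w_nonzero norm_Q [OF assms] deriv_w_nonzero(2) assms by (auto simp: defs)
  have z: "z \<in> ball 0 1" using assms by simp
  have s1: "z * s1 = w1 - s z"
    using deriv_w [OF assms] by (simp add: defs)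
  have ders: "(s has_field_derivative s1) (at z)" "(w has_field_derivative w1) (at z)"
      "(deriv w has_field_derivative w2) (at z)"
    unfolding defs using s_deriv assms w_holo z
    by (auto intro!: holomorphic_derivI holomorphic_deriv)
  have L: "((\<lambda>z. (1 - z) * deriv w z) has_field_derivative (0 - 1) * w1 + w2 * (1 - z)) (at z)"
    unfolding defs(1) using ders by (intro DERIV_mult DERIV_diff DERIV_const DERIV_ident)
  \<comment> \<open>Writing \<open>w z - 1\<close> for \<open>z * s z\<close> makes its derivative
    \<open>w1\<close>, so that \<open>s1\<close> enters only once.\<close>
  have R: "((\<lambda>z. of_real b + of_real (a + b) * (w z - 1) - of_real a * ((1 - z) * ((w z - 1) * s z)))
      has_field_derivative 0 + of_real (a + b) * (w1 - 0)
        - of_real a * ((0 - 1) * ((w z - 1) * s z) + ((w1 - 0) * s z + s1 * (w z - 1)) * (1 - z))) (at z)"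
    using ders by (intro DERIV_add DERIV_diff DERIV_cmult DERIV_mult DERIV_const DERIV_ident)
  have "((\<lambda>z. (1 - z) * deriv w z) has_field_derivative 0 + of_real (a + b) * (w1 - 0)
        - of_real a * ((0 - 1) * ((w z - 1) * s z) + ((w1 - 0) * s z + s1 * (w z - 1)) * (1 - z))) (at z)"
    by (rule has_field_derivative_transform_within_open [OF R, of "ball 0 1"])
      (use assms w_ode in \<open>auto simp: w_def power2_eq_square mult_ac\<close>)
  from DERIV_unique [OF L this]
  have "w2 * (1 - z) = w1 + of_real (a + b) * w1
      - of_real a * (w1 * s z * (1 - z) + s1 * (w z - 1) * (1 - z) - (w z - 1) * s z)"
    by (simp add: algebra_simps)
  \<comment> \<open>The factor \<open>z\<close> turns \<open>s1\<close> into
    \<open>z * s1 = w1 - s z\<close>; the leftover \<open>a * z * (s z)^2\<close> is then expressed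
    by \<open>w1\<close> and \<open>Q\<close>.\<close>
  then have "z * (w2 * (1 - z)) = z * (w1 + of_real (a + b) * w1)
      - of_real a * (w1 * (z * s z) * (1 - z) + (z * s1) * (w z - 1) * (1 - z) - z * (w z - 1) * s z)"
    by (simp only: right_diff_distrib distrib_left mult_ac)
  also have "\<dots> = of_real (1 + a + b) * (z * w1) - 2 * of_real a * (1 - z) * w1 * (z * s z)
      + of_real a * z * (s z)\<^sup>2"
    unfolding s1 w_def by (simp add: power2_eq_square algebra_simps)
  also have "of_real a * z * (s z)\<^sup>2 = Q z * ((1 - z) * w1 / (1 - Q z))"
    using ne deriv_w_nonzero(1) [OF assms] by (simp add: Q_def defs)
  finally have "z * w2 * (1 - z) = (of_real (1 + a + b) * (z / (1 - z)) - 2 * of_real a * (z * s z)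
      + Q z / (1 - Q z)) * w1 * (1 - z)"
    using ne by (simp add: divide_simps) (simp add: algebra_simps)
  then have "z * w2 = (of_real (1 + a + b) * (z / (1 - z)) - 2 * of_real a * (z * s z)
      + Q z / (1 - Q z)) * w1"
    by simp
  then show ?thesis
    using ne unfolding defs [symmetric] by (simp add: w_def)
qed

text \<open>Divided by \<open>1 - Q z\<close>, this splits \<open>Q / (1 - Q)\<close> into a term
  linear in \<open>w\<close> and a multiple of the quotient in \<open>Re_quotient_nonneg\<close>. It
  is checked after clearing the denominators \<open>w z\<close> and \<open>V\<close>.\<close>

lemma Q_identity:
  assumes "norm z < 1"
  shows "of_real (a + b) * Q z = of_real a * (1 - A z + y z - (2 - w z) * (1 - Q z))"
proof -
  define V where "V = of_real a * (z * s z) + of_real b"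
  have ne: "w z \<noteq> 0" "V \<noteq> 0"
    using w_nonzero norm_Q(2) assms by (auto simp: V_def)
  have Q: "Q z * (w z * V) = of_real a * z * (s z)\<^sup>2"
    using ne by (simp add: Q_def V_def)
  have A: "A z * w z = s z"
    using ne by (simp add: A_def)
  have "of_real (a + b) * Q z * (w z * V) = of_real a * (1 - A z + y z - (2 - w z) * (1 - Q z)) * (w z * V)"
  proof -
    have "of_real a * (1 - A z + y z - (2 - w z) * (1 - Q z)) * (w z * V) =
        of_real a * ((w z - A z * w z + y z * w z) * V - (2 - w z) * (w z * V - Q z * (w z * V)))"
      by (simp add: algebra_simps)
    also have "\<dots> = of_real (a + b) * (of_real a * z * (s z)\<^sup>2)"
      unfolding Q A by (simp add: V_def y_def w_def power2_eq_square algebra_simps)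
    also have "\<dots> = of_real (a + b) * Q z * (w z * V)"
      by (subst Q [symmetric]) (simp only: mult.assoc)
    finally show ?thesis by (rule sym)
  qed
  moreover have "w z * V \<noteq> 0" using ne by simp
  ultimately show ?thesis by (metis mult_right_cancel)
qed

lemma Re_second_log_deriv:
  assumes "norm z < 1"
  shows "1 + Re (z * deriv (deriv w) z / deriv w z) \<ge>
    (3 * a - b - 1) / 2 + (b + b\<^sup>2 - 2 * a\<^sup>2 - 3 * a * b) / ((1 + b) * (a + b))"
proof -
  define c where "c = a / (a + b)"
  have ab: "a + b > 0" using a_pos b_pos by simp
  \<comment> \<open>Here \<open>a + b \<le> 1/2\<close> makes the total coefficient
    \<open>c - 2 * a\<close> of \<open>Re w\<close> nonnegative, so that the lower bound on
    \<open>Re w\<close> can be used.\<close>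
  have "a * (a + b) \<le> a * (1 / 2)"
    using a_pos ab_le by (intro mult_left_mono) auto
  then have c: "c > 0" "c \<ge> 2 * a"
    using a_pos ab by (simp_all add: c_def pos_le_divide_eq)
  have "1 - Q z \<noteq> 0" using norm_Q(1) [OF assms] by auto
  have "Re (z / (1 - z)) \<ge> - (1 / 2)"
  proof -
    have Re_eq: "Re (z / (1 - z)) = (Re z - (norm z)\<^sup>2) / (norm (1 - z))\<^sup>2"
      unfolding Re_divide cmod_power2 by (simp add: power2_eq_square algebra_simps)
    have N: "0 < (norm (1 - z))\<^sup>2" using assms by auto
    have "(norm z)\<^sup>2 \<le> 1"
      using assms by (simp add: power_le_one)
    moreover have "(norm (1 - z))\<^sup>2 = 1 - 2 * Re z + (norm z)\<^sup>2"
      unfolding cmod_power2 by (simp add: power2_eq_square algebra_simps)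
    ultimately have "- ((norm (1 - z))\<^sup>2 / 2) \<le> Re z - (norm z)\<^sup>2"
      by argo
    with Re_eq N show ?thesis by (simp add: pos_le_divide_eq)
  qed
  then have p: "(1 + a + b) * Re (z / (1 - z)) \<ge> (1 + a + b) * - (1 / 2)"
    using ab by (intro mult_left_mono) auto
  have div_diff_mult: "k * (m - n * d) / d = k * (m / d - n)" if "d \<noteq> 0" for k m n d :: complex
    using that by (simp add: field_simps)
  have "of_real (a + b) * Q z = of_real (a + b) * (of_real c * (1 - A z + y z - (2 - w z) * (1 - Q z)))"
    unfolding Q_identity [OF assms] c_def using ab
    by (simp only: flip: mult.assoc of_real_mult) simp
  then have "Q z = of_real c * (1 - A z + y z - (2 - w z) * (1 - Q z))"
    using ab by (simp only: mult_left_cancel of_real_eq_0_iff)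
  then have "Q z / (1 - Q z) = of_real c * (1 - A z + y z - (2 - w z) * (1 - Q z)) / (1 - Q z)"
    by (rule arg_cong [where f = "\<lambda>u. u / (1 - Q z)"])
  also have "\<dots> = of_real c * ((1 - A z + y z) / (1 - Q z) - (2 - w z))"
    using \<open>1 - Q z \<noteq> 0\<close> by (rule div_diff_mult)
  finally have "Q z / (1 - Q z) = of_real c * ((1 - A z + y z) / (1 - Q z) - (2 - w z))" .
  then have "Re (Q z / (1 - Q z)) = c * (Re ((1 - A z + y z) / (1 - Q z)) - (2 - Re (w z)))"
    by simp
  moreover have "c * Re ((1 - A z + y z) / (1 - Q z)) \<ge> 0"
    using c Re_quotient_nonneg [OF assms] by simp
  ultimately have q: "Re (Q z / (1 - Q z)) \<ge> c * Re (w z) - 2 * c"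
    by (simp add: algebra_simps)
  have w: "(c - 2 * a) * Re (w z) \<ge> (c - 2 * a) * (1 / (1 + b))"
    using c Re_w [OF assms] by (intro mult_left_mono) auto
  have Re_mult: "Re (of_real r * u) = r * Re u" for r u
    by simp
  have two: "2 * complex_of_real a = of_real (2 * a)"
    by simp
  have "Re (z * deriv (deriv w) z / deriv w z) =
      (1 + a + b) * Re (z / (1 - z)) - 2 * a * (Re (w z) - 1) + Re (Q z / (1 - Q z))"
    unfolding second_log_deriv [OF assms] two
    by (simp only: plus_complex.sel minus_complex.sel one_complex.sel Re_mult)
  then have "1 + Re (z * deriv (deriv w) z / deriv w z)
      \<ge> 1 - (1 + a + b) / 2 + 2 * a - 2 * c + (c - 2 * a) * (1 / (1 + b))"
    using p q w by (simp add: algebra_simps)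
  moreover have "1 - (1 + a + b) / 2 + 2 * a - 2 * c + (c - 2 * a) * (1 / (1 + b)) =
      (3 * a - b - 1) / 2 + (b + b\<^sup>2 - 2 * a\<^sup>2 - 3 * a * b) / ((1 + b) * (a + b))"
  proof -
    have "1 + b \<noteq> 0" "a + b \<noteq> 0" using ab b_pos by auto
    then show ?thesis
      by (simp add: c_def divide_simps) (simp add: power2_eq_square algebra_simps)
  qed
  ultimately show ?thesis by simp
qed

text \<open>The two functions are known to agree only in the disc, so derivatives are compared on
  neighbourhoods inside it.\<close>

lemma deriv_hyp_ratio:
  assumes "norm z < 1"
  shows "deriv (hyp_ratio (of_real a) (of_real b) 1) z = deriv w z"
    and "deriv (deriv (hyp_ratio (of_real a) (of_real b) 1)) z = deriv (deriv w) z"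
proof -
  let ?h = "hyp_ratio (of_real a) (of_real b) 1"
  have *: "deriv ?h z = deriv w z" if "norm z < 1" for z
  proof (rule deriv_cong_ev)
    show "\<forall>\<^sub>F x in nhds z. ?h x = w x"
      using that hyp_ratio_eq_w by (intro eventually_nhds_in_open [THEN eventually_mono, of "ball 0 1"]) auto
  qed simp
  then show "deriv ?h z = deriv w z" using assms by blast
  show "deriv (deriv ?h) z = deriv (deriv w) z"
  proof (rule deriv_cong_ev)
    show "\<forall>\<^sub>F x in nhds z. deriv ?h x = deriv w x"
      using assms * by (intro eventually_nhds_in_open [THEN eventually_mono, of "ball 0 1"]) auto
  qed simp
qed

lemma hyp_kappa_ge:
  "hyp_kappa (of_real a) (of_real b) 1 \<ge>
    ereal ((3 * a - b - 1) / 2 + (b + b\<^sup>2 - 2 * a\<^sup>2 - 3 * a * b) / ((1 + b) * (a + b)))"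
    (is "_ \<ge> ereal ?B")
proof -
  let ?h = "hyp_ratio (of_real a) (of_real b) 1"
  have "ereal (?B - 1) \<le> (INF z\<in>ball 0 1. if deriv ?h z = 0 then - \<infinity>
      else ereal (Re (z * deriv (deriv ?h) z / deriv ?h z)))"
  proof (rule INF_greatest)
    fix z :: complex assume "z \<in> ball 0 1"
    then have "norm z < 1" by simp
    \<comment> \<open>Since \<open>deriv w\<close> has no zeros in the disc, the value
      \<open>-\<infinity>\<close> is never taken.\<close>
    then show "ereal (?B - 1) \<le> (if deriv ?h z = 0 then - \<infinity>
        else ereal (Re (z * deriv (deriv ?h) z / deriv ?h z)))"
      using Re_second_log_deriv [of z] deriv_w_nonzero(2) [of z] by (simp add: deriv_hyp_ratio)
  qed
  then have "1 + ereal (?B - 1) \<le> hyp_kappa (of_real a) (of_real b) 1"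
    unfolding hyp_kappa_def order_of_convexity_def by (rule add_left_mono)
  moreover have "1 + ereal (?B - 1) = ereal ?B"
    by (simp add: one_ereal_def)
  ultimately show ?thesis by simp
qed

lemma hyp_ratio_not_constant: "\<not> hyp_ratio (of_real a) (of_real b) 1 constant_on ball 0 1"
proof
  let ?h = "hyp_ratio (of_real a) (of_real b) 1"
  assume "?h constant_on ball 0 1"
  then obtain c where c: "\<And>z. norm z < 1 \<Longrightarrow> ?h z = c"
    by (auto simp: constant_on_def)
  have "deriv ?h 0 = deriv (\<lambda>_. c) 0"
  proof (rule deriv_cong_ev)
    show "\<forall>\<^sub>F x in nhds 0. ?h x = c"
      using c by (intro eventually_nhds_in_open [THEN eventually_mono, of "ball 0 1"]) auto
  qed simp
  then show False
    using deriv_w_nonzero(2) [of 0] by (simp add: deriv_hyp_ratio)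
qed

end

theorem corollary1p3:
  fixes a b :: real
  assumes "0 < a" and "a \<le> b" and "a + b \<le> 1 / 2"
  shows "hyp_kappa (of_real a) (of_real b) 1 \<ge>
           ereal ((3 * a - b - 1) / 2 + (b + b^2 - 2 * a^2 - 3 * a * b) / ((1 + b) * (a + b)))
       \<and> ((3 * b - 1) * a^2 + (2 * b^2 - 5 * b - 1) * a + b * (1 - b^2) \<ge> 0
            \<longrightarrow> convex_function_on_disc (hyp_ratio (of_real a) (of_real b) 1))"
proof -
  interpret hyp_ratio_params a b
    using assms by unfold_locales
  let ?h = "hyp_ratio (of_real a) (of_real b) 1"
  let ?B = "(3 * a - b - 1) / 2 + (b + b\<^sup>2 - 2 * a\<^sup>2 - 3 * a * b) / ((1 + b) * (a + b))"
  have "convex_function_on_disc ?h"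
    if cubic: "(3 * b - 1) * a^2 + (2 * b^2 - 5 * b - 1) * a + b * (1 - b^2) \<ge> 0"
  proof -
    have pos: "1 + b > 0" "a + b > 0" using assms by auto
    then have [simp]: "1 + b \<noteq> 0" "a + b \<noteq> 0" by auto
    \<comment> \<open>The cubic is the numerator of the bound over a positive common
      denominator.\<close>
    have "?B = ((3 * b - 1) * a^2 + (2 * b^2 - 5 * b - 1) * a + b * (1 - b^2)) / (2 * ((1 + b) * (a + b)))"
      by (simp add: divide_simps) (simp add: power2_eq_square algebra_simps)
    then have "?B \<ge> 0" using cubic pos by simp
    then have "0 \<le> order_of_convexity ?h"
      using hyp_kappa_ge unfolding hyp_kappa_def by (meson ereal_less_eq(5) order_trans)
    moreover have "?h holomorphic_on ball 0 1"
      using w_holo by (rule holomorphic_transform) (simp add: hyp_ratio_eq_w)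
    ultimately show ?thesis
      using hyp_ratio_not_constant by (simp add: convex_function_on_disc_def)
  qed
  then show ?thesis using hyp_kappa_ge by blast
qed

end
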